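(* Let $G$ be a group (not necessarily finite), and let $X,Y,Z\subseteq G$ be finite subsets satisfying the triple product property. If $R_{\mathrm{sep}}$ is a finite set of finite-dimensional complex representations of $G$ such that $\mathrm{RepFun}(R_{\mathrm{sep}})$ contains a set of separating functions for $(X,Y,Z)$, then $$\left(|X|\,|Y|\,|Z|\right)^{\omega/3}\le \sum_{\rho\in R_{\mathrm{sep}}}(\dim\rho)^{\omega}.$$ In particular, for $D=\sum_{\rho\in R_{\mathrm{sep}}}(\dim\rho)^2$ and $d_{\max}=\max\{\dim\rho:\rho\in R_{\mathrm{sep}}\}$, $$\left(|X|\,|Y|\,|Z|\right)^{\omega/3}\le D\cdot d_{\max}^{\omega-2}.$$
   Context: $\omega$ is the exponent of matrix multiplication (over $\mathbb{C}$): the smallest number such that $n\times n$ matrices can be multiplied using $n^{\omega+o(1)}$ arithmetic operations. Triple product property (TPP): subsets $X,Y,Z$ of a group $G$ satisfy the TPP if for all $x,x'\in X$, $y,y'\in Y$, $z,z'\in Z$: $x^{-1}x'\,y^{-1}y'\,z^{-1}z'=1$ if and only if $x=x'$, $y=y'$, $z=z'$. Separating functions: a set of separating functions for $(X,Y,Z)$ is a collection of functions $\{f_{x,z}\colon G\to\mathbb{C}\mid x\in X,z\in Z\}$ such that $f_{x,z}(g)=1$ if $g=xz^{-1}$ and $f_{x,z}(g)=0$ if $g\in XY^{-1}YZ^{-1}\setminus\{xz^{-1}\}$. For a finite-dimensional representation $\rho\colon G\to \mathrm{GL}_d(\mathbb{C})$, a representative function associated to $\rho$ is any function $G\to\mathbb{C}$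 in the $\mathbb{C}$-linear span of the matrix entry functions $g\mapsto\rho(g)_{i,j}$, $1\le i,j\le d$. For a set $\mathcal{I}$ of such representations, $\mathrm{RepFun}(\mathcal{I})$ is the $\mathbb{C}$-linear span of all representative functions of the representations in $\mathcal{I}$. *)

theory Defs
  imports
    "HOL-Analysis.Analysis"
    "HOL-Algebra.Coset"
    "HOL-Library.Function_Algebras"
    "Jordan_Normal_Form.Matrix"
begin

text \<open>
  Division-by-zero-free straight-line programs over the complex numbers.  \<open>straight_line D I S k\<close>
  says that \<open>k\<close> arithmetic operations suffice to compute all functions in \<open>S\<close> from the inputs \<open>I\<close>
  and arbitrary scalar constants, which are free of charge.  A division is admitted only if the
  denominator vanishes nowhere on the input domain \<open>D\<close>, so the convention \<open>x / 0 = 0\<close> is never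
  exploited.
\<close>

inductive straight_line ::
  "'x set \<Rightarrow> ('x \<Rightarrow> complex) set \<Rightarrow> ('x \<Rightarrow> complex) set \<Rightarrow> nat \<Rightarrow> bool"
  for D :: "'x set" and I :: "('x \<Rightarrow> complex) set" where
  start: "straight_line D I (I \<union> range (\<lambda>c x. c)) 0"
| add: "straight_line D I S k \<Longrightarrow> f \<in> S \<Longrightarrow> g \<in> S \<Longrightarrow>
    straight_line D I (insert (\<lambda>x. f x + g x) S) (Suc k)"
| sub: "straight_line D I S k \<Longrightarrow> f \<in> S \<Longrightarrow> g \<in> S \<Longrightarrow>
    straight_line D I (insert (\<lambda>x. f x - g x) S) (Suc k)"
| mult: "straight_line D I S k \<Longrightarrow> f \<in> S \<Longrightarrow> g \<in> S \<Longrightarrow>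
    straight_line D I (insert (\<lambda>x. f x * g x) S) (Suc k)"
| divide: "straight_line D I S k \<Longrightarrow> f \<in> S \<Longrightarrow> g \<in> S \<Longrightarrow> (\<forall>x\<in>D. g x \<noteq> 0) \<Longrightarrow>
    straight_line D I (insert (\<lambda>x. f x / g x) S) (Suc k)"

definition mm_domain :: "nat \<Rightarrow> (complex mat \<times> complex mat) set" where
  "mm_domain n = carrier_mat n n \<times> carrier_mat n n"

definition mm_inputs :: "nat \<Rightarrow> (complex mat \<times> complex mat \<Rightarrow> complex) set" where
  "mm_inputs n =
     {(\<lambda>(A, B). A $$ (i, j)) | i j. i < n \<and> j < n} \<union> {(\<lambda>(A, B). B $$ (i, j)) | i j. i < n \<and> j < n}"

definition mm_computable :: "nat \<Rightarrow> nat \<Rightarrow> bool" where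
  "mm_computable n k \<longleftrightarrow> (\<exists>S. straight_line (mm_domain n) (mm_inputs n) S k \<and>
     (\<forall>i<n. \<forall>j<n. \<exists>h\<in>S. \<forall>(A, B)\<in>mm_domain n. h (A, B) = (A * B) $$ (i, j)))"

definition mm_ops :: "nat \<Rightarrow> nat" where
  "mm_ops n = (LEAST k. mm_computable n k)"

definition mm_exponent :: real where
  "mm_exponent = Inf {w. \<exists>e :: nat \<Rightarrow> real. e \<longlonglongrightarrow> 0 \<and>
     (\<forall>\<^sub>F n in sequentially. real (mm_ops n) \<le> real n powr (w + e n))}"

definition triple_product_property ::
  "('g, 'm) monoid_scheme \<Rightarrow> 'g set \<Rightarrow> 'g set \<Rightarrow> 'g set \<Rightarrow> bool" where
  "triple_product_property G X Y Z \<longleftrightarrow>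
     (\<forall>x\<in>X. \<forall>x'\<in>X. \<forall>y\<in>Y. \<forall>y'\<in>Y. \<forall>z\<in>Z. \<forall>z'\<in>Z.
        inv\<^bsub>G\<^esub> x \<otimes>\<^bsub>G\<^esub> x' \<otimes>\<^bsub>G\<^esub> inv\<^bsub>G\<^esub> y \<otimes>\<^bsub>G\<^esub> y' \<otimes>\<^bsub>G\<^esub> inv\<^bsub>G\<^esub> z \<otimes>\<^bsub>G\<^esub> z' = \<one>\<^bsub>G\<^esub>
        \<longleftrightarrow> x = x' \<and> y = y' \<and> z = z')"

definition separating_functions ::
  "('g, 'm) monoid_scheme \<Rightarrow> 'g set \<Rightarrow> 'g set \<Rightarrow> 'g set \<Rightarrow> ('g \<Rightarrow> 'g \<Rightarrow> 'g \<Rightarrow> complex) \<Rightarrow> bool"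
where
  "separating_functions G X Y Z f \<longleftrightarrow>
     (\<forall>x\<in>X. \<forall>z\<in>Z.
        f x z (x \<otimes>\<^bsub>G\<^esub> inv\<^bsub>G\<^esub> z) = 1 \<and>
        (\<forall>g \<in> (X <#>\<^bsub>G\<^esub> (set_inv\<^bsub>G\<^esub> Y) <#>\<^bsub>G\<^esub> Y <#>\<^bsub>G\<^esub> (set_inv\<^bsub>G\<^esub> Z)) - {x \<otimes>\<^bsub>G\<^esub> inv\<^bsub>G\<^esub> z}. f x z g = 0))"

definition GL :: "nat \<Rightarrow> complex mat monoid" where
  "GL d = units_of (ring_mat TYPE(complex) d ())"

definition rep_dim :: "('g, 'm) monoid_scheme \<Rightarrow> ('g \<Rightarrow> complex mat) \<Rightarrow> nat" where
  "rep_dim G \<rho> = dim_row (\<rho> \<one>\<^bsub>G\<^esub>)"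

definition fin_dim_rep :: "('g, 'm) monoid_scheme \<Rightarrow> ('g \<Rightarrow> complex mat) \<Rightarrow> bool" where
  "fin_dim_rep G \<rho> \<longleftrightarrow> \<rho> \<in> hom G (GL (rep_dim G \<rho>))"

text \<open>
  Functions on the group are modelled as total functions on the underlying type.  Their values
  outside the carrier are irrelevant, since separation only constrains values on the carrier.
\<close>

definition fun_span :: "('g \<Rightarrow> complex) set \<Rightarrow> ('g \<Rightarrow> complex) set" where
  "fun_span = module.span (\<lambda>c f g. c * f g)"

lemma vector_space_fun: "vector_space (\<lambda>(c :: complex) (f :: 'g \<Rightarrow> complex) g. c * f g)"
  by unfold_locales (auto simp: fun_eq_iff algebra_simps)

definition rep_functions :: "('g, 'm) monoid_scheme \<Rightarrow> ('g \<Rightarrow> complex mat) \<Rightarrow> ('g \<Rightarrow> complex) set"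
where
  "rep_functions G \<rho> = fun_span {(\<lambda>g. \<rho> g $$ (i, j)) | i j. i < rep_dim G \<rho> \<and> j < rep_dim G \<rho>}"

definition RepFun ::
  "('g, 'm) monoid_scheme \<Rightarrow> ('g \<Rightarrow> complex mat) set \<Rightarrow> ('g \<Rightarrow> complex) set" where
  "RepFun G R = fun_span (\<Union>\<rho>\<in>R. rep_functions G \<rho>)"

end

theory Submission
  imports
    Defs
    "HOL-Computational_Algebra.Fundamental_Theorem_Algebra"
    "HOL-Real_Asymp.Real_Asymp"
    "Jordan_Normal_Form.Determinant"
begin

text \<open>
  Write \<open>\<langle>m, n, p\<rangle>\<close> for the tensor of the multiplication of \<open>m \<times> n\<close> by \<open>n \<times> p\<close> matrices and \<open>\<omega>\<close> for
  the exponent.  If \<open>f x z\<close> are the separating functions, then the triple product property says that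
  \<open>f x' z' ((x y\<inverse>) (y' z\<inverse>))\<close> is \<open>1\<close> if \<open>x = x'\<close>, \<open>y = y'\<close>, \<open>z = z'\<close>, and \<open>0\<close> otherwise.  Expanding
  \<open>f x' z'\<close> in matrix entries \<open>\<rho> g $$ (a, c)\<close>, and \<open>\<rho> (g h)\<close> as \<open>\<rho> g * \<rho> h\<close>, turns this into a
  restriction of \<open>\<langle>|X|, |Y|, |Z|\<rangle>\<close> to the direct sum of the tensors \<open>\<langle>d, d, d\<rangle>\<close> over the dimensions
  \<open>d\<close> of the representations (\<open>separating_functions_restriction\<close>).

  The inequality for such a restriction (\<open>mm_restriction_bound\<close>) is the tensor power argument.  Let
  \<open>\<beta> > \<omega>\<close>, so that \<open>\<langle>d, d, d\<rangle>\<close> has rank at most \<open>C * d powr \<beta>\<close> for all \<open>d\<close>.  Expanding an \<open>N\<close>-fold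
  power of the direct sum one factor at a time, \<open>\<langle>|X|^N, |Y|^N, |Z|^N\<rangle>\<close> has rank at most
  \<open>C * (\<Sum>\<rho>. d\<^sub>\<rho> powr \<beta>) ^ N\<close> (\<open>mm_restriction_power_rank\<close>).  The tensor product of its three
  cyclic rotations has square format of size \<open>M ^ N\<close>, where \<open>M = |X| |Y| |Z|\<close>; and a square
  format of size \<open>m\<close> and rank \<open>r\<close> satisfies \<open>m powr \<omega> \<le> r + 1\<close>.  Taking \<open>N\<close>-th roots removes the
  constants, and then \<open>\<beta>\<close> tends to \<open>\<omega>\<close>.

  What remains is the relation between \<open>\<omega>\<close>, which is defined by operation counts, and rank.
  In one direction (\<open>mm_rank_le_of_computable\<close>), a program with \<open>k\<close> operations yields a
  decomposition of length \<open>2 k\<close>: restricted to lines through the origin its intermediate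
  results are polynomials, and their coefficients of degree two are combinations of \<open>k\<close> products of
  linear forms.  In the other (\<open>mm_computable_powers\<close>), a decomposition of \<open>\<langle>M, M, M\<rangle>\<close> is a recursive
  algorithm for block matrices.  The bound \<open>n\<^sup>2 \<le> r\<close> for the rank of \<open>\<langle>n, n, n\<rangle>\<close> controls the
  linear operations in the recursion, and it gives \<open>2 \<le> \<omega>\<close>, which the second inequality needs.
\<close>

section \<open>Composing straight-line programs\<close>

text \<open>
  \<open>slp_extends D I S\<^sub>0 F q\<close> says that every straight-line program that has already computed the
  functions in \<open>S\<^sub>0\<close> can be continued by \<open>q\<close> further operations so as to compute those in \<open>F\<close> too.
  Quantifying over all programs makes such costs additive.
\<close>

definition slp_extends ::
  "'x set \<Rightarrow> ('x \<Rightarrow> complex) set \<Rightarrow> ('x \<Rightarrow> complex) set \<Rightarrow> ('x \<Rightarrow> complex) set \<Rightarrow> nat \<Rightarrow> bool"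
where
  "slp_extends D I S\<^sub>0 F q \<longleftrightarrow> (\<forall>S k. straight_line D I S k \<and> S\<^sub>0 \<subseteq> S \<longrightarrow>
     (\<exists>S'. S \<subseteq> S' \<and> F \<subseteq> S' \<and> straight_line D I S' (k + q)))"

lemma straight_line_const: "straight_line D I S k \<Longrightarrow> (\<lambda>x. c) \<in> S"
  by (induction rule: straight_line.induct) auto

lemma slp_extendsI:
  assumes "\<And>S k. straight_line D I S k \<Longrightarrow> S\<^sub>0 \<subseteq> S \<Longrightarrow>
    \<exists>S'. S \<subseteq> S' \<and> F \<subseteq> S' \<and> straight_line D I S' (k + q)"
  shows "slp_extends D I S\<^sub>0 F q"
  unfolding slp_extends_def using assms by simp

lemma slp_extendsE:
  assumes "slp_extends D I S\<^sub>0 F q" "straight_line D I S k" "S\<^sub>0 \<subseteq> S"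
  obtains S' where "S \<subseteq> S'" "F \<subseteq> S'" "straight_line D I S' (k + q)"
  using assms(1)[unfolded slp_extends_def, rule_format, OF conjI, OF assms(2,3)] by (elim exE conjE)

lemma slp_extends_mono:
  assumes "slp_extends D I S\<^sub>0 F q" "S\<^sub>0 \<subseteq> S\<^sub>1" "F' \<subseteq> F"
  shows "slp_extends D I S\<^sub>1 F' q"
proof (rule slp_extendsI)
  fix S k assume S: "straight_line D I S k" "S\<^sub>1 \<subseteq> S"
  have "S\<^sub>0 \<subseteq> S" using S(2) assms(2) by blast
  from slp_extendsE[OF assms(1) S(1) this]
  obtain S' where "S \<subseteq> S'" "F \<subseteq> S'" "straight_line D I S' (k + q)" .
  then show "\<exists>S'. S \<subseteq> S' \<and> F' \<subseteq> S' \<and> straight_line D I S' (k + q)"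
    using assms(3) by (intro exI[of _ S']) auto
qed

lemma slp_extends_trans:
  assumes "slp_extends D I S\<^sub>0 F q" "slp_extends D I (S\<^sub>0 \<union> F) F' q'"
  shows "slp_extends D I S\<^sub>0 (F \<union> F') (q + q')"
proof (rule slp_extendsI)
  fix S k assume S: "straight_line D I S k" "S\<^sub>0 \<subseteq> S"
  obtain S1 where S1: "S \<subseteq> S1" "F \<subseteq> S1" "straight_line D I S1 (k + q)"
    using slp_extendsE[OF assms(1) S] .
  have "S\<^sub>0 \<union> F \<subseteq> S1"
    using S1 S by blast
  from slp_extendsE[OF assms(2) S1(3) this]
  obtain S2 where "S1 \<subseteq> S2" "F' \<subseteq> S2" "straight_line D I S2 (k + q + q')" .
  with S1 show "\<exists>S'. S \<subseteq> S' \<and> F \<union> F' \<subseteq> S' \<and> straight_line D I S' (k + (q + q'))"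
    by (intro exI[of _ S2]) (auto simp: add.assoc)
qed

lemma slp_extends_empty: "slp_extends D I S\<^sub>0 {} 0"
  by (rule slp_extendsI) auto

lemma slp_extends_UN:
  assumes "finite T" "\<And>t. t \<in> T \<Longrightarrow> slp_extends D I S\<^sub>0 (F t) q"
  shows "slp_extends D I S\<^sub>0 (\<Union>t\<in>T. F t) (card T * q)"
  using assms
proof (induction T rule: finite_induct)
  case empty
  then show ?case by (simp add: slp_extends_empty)
next
  case (insert t T)
  have "slp_extends D I S\<^sub>0 (F t \<union> (\<Union>t\<in>T. F t)) (q + card T * q)"
    by (rule slp_extends_trans) (use insert in \<open>auto intro: slp_extends_mono\<close>)
  then show ?case using insert.hyps by simp
qed

lemma slp_extends_lincomb:
  fixes g :: "'t \<Rightarrow> 'x \<Rightarrow> complex"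
  assumes "finite T" "\<And>t. t \<in> T \<Longrightarrow> g t \<in> S\<^sub>0"
  shows "slp_extends D I S\<^sub>0 {\<lambda>x. \<Sum>t\<in>T. c t * g t x} (2 * card T)"
  using assms
proof (induction T rule: finite_induct)
  case empty
  then show ?case
    by (intro slp_extendsI) (auto intro: straight_line_const)
next
  case (insert t T)
  show ?case
    proof (rule slp_extendsI)
    fix S k assume S: "straight_line D I S k" "S\<^sub>0 \<subseteq> S"
    have "slp_extends D I S\<^sub>0 {\<lambda>x. \<Sum>t\<in>T. c t * g t x} (2 * card T)"
      using insert by simp
    from slp_extendsE[OF this S]
    obtain S1 where S1: "S \<subseteq> S1" "{\<lambda>x. \<Sum>t\<in>T. c t * g t x} \<subseteq> S1"
        "straight_line D I S1 (k + 2 * card T)" .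
    have "g t \<in> S1" using insert.prems S(2) S1(1) by auto
    with S1 have "straight_line D I (insert (\<lambda>x. c t * g t x) S1) (Suc (k + 2 * card T))"
      by (intro straight_line.mult straight_line_const)
    then have "straight_line D I (insert (\<lambda>x. c t * g t x + (\<Sum>t\<in>T. c t * g t x))
        (insert (\<lambda>x. c t * g t x) S1)) (Suc (Suc (k + 2 * card T)))"
      using S1 by (intro straight_line.add) auto
    then show "\<exists>S'. S \<subseteq> S' \<and> {\<lambda>x. \<Sum>t\<in>insert t T. c t * g t x} \<subseteq> S'
        \<and> straight_line D I S' (k + 2 * card (insert t T))"
      using S1 insert.hyps
      by (intro exI[of _ "insert (\<lambda>x. c t * g t x + (\<Sum>t\<in>T. c t * g t x))
        (insert (\<lambda>x. c t * g t x) S1)"]) auto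
  qed
qed

text \<open>
  A program on the domain \<open>D'\<close> may be run after a substitution \<open>\<phi>\<close> of its inputs, as long as \<open>\<phi>\<close>
  maps into \<open>D'\<close>: this keeps the denominators nonzero.
\<close>

lemma slp_extends_compose:
  fixes \<phi> :: "'x \<Rightarrow> 'y"
  assumes "straight_line D' I' S' q" and \<phi>: "\<phi> ` D \<subseteq> D'"
  shows "slp_extends D I ((\<lambda>h x. h (\<phi> x)) ` I') ((\<lambda>h x. h (\<phi> x)) ` S') q"
    (is "slp_extends D I ?S0 (?c ` S') q")
proof -
  have step: "slp_extends D I ?S0 (?c ` insert h S) (Suc q)"
    if ih: "slp_extends D I ?S0 (?c ` S) q"
      and h: "\<And>S1 k. straight_line D I S1 k \<Longrightarrow> ?c ` S \<subseteq> S1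
                \<Longrightarrow> straight_line D I (insert (?c h) S1) (Suc k)"
    for S q h
    proof (rule slp_extendsI)
    fix S2 k assume S2: "straight_line D I S2 k" "?S0 \<subseteq> S2"
    obtain S1 where S1: "S2 \<subseteq> S1" "?c ` S \<subseteq> S1" "straight_line D I S1 (k + q)"
      using slp_extendsE[OF ih S2] .
    show "\<exists>S'. S2 \<subseteq> S' \<and> ?c ` insert h S \<subseteq> S' \<and> straight_line D I S' (k + Suc q)"
      using S1 h[OF S1(3,2)] by (intro exI[of _ "insert (?c h) S1"]) auto
  qed
  from assms(1) show ?thesis
  proof (induction rule: straight_line.induct)
    case start
    show ?case
      proof (rule slp_extendsI)
      fix S k assume "straight_line D I S k" "?S0 \<subseteq> S"
      then show "\<exists>S'. S \<subseteq> S' \<and> ?c ` (I' \<union> range (\<lambda>c x. c)) \<subseteq> S' \<and> straight_line D I S' (k + 0)"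
        by (intro exI[of _ S]) (auto intro: straight_line_const)
    qed
  next
    case (add S k f g)
    then show ?case by (intro step) (auto intro!: straight_line.add)
  next
    case (sub S k f g)
    then show ?case by (intro step) (auto intro!: straight_line.sub)
  next
    case (mult S k f g)
    then show ?case by (intro step) (auto intro!: straight_line.mult)
  next
    case (divide S k f g)
    have "\<forall>x\<in>D. g (\<phi> x) \<noteq> 0" using divide \<phi> by blast
    with divide show ?case by (intro step) (auto intro!: straight_line.divide)
  qed
qed

section \<open>Programs for matrix multiplication\<close>

lemma mm_inputs_eq:
  "mm_inputs n = (\<lambda>(i, j) AB. fst AB $$ (i, j)) ` ({..<n} \<times> {..<n})
     \<union> (\<lambda>(i, j) AB. snd AB $$ (i, j)) ` ({..<n} \<times> {..<n})"
  unfolding mm_inputs_def by (fastforce simp: case_prod_unfold image_iff)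

lemma mm_computableI:
  assumes "slp_extends (mm_domain n) (mm_inputs n) (mm_inputs n) F q"
    and "\<And>i j. i < n \<Longrightarrow> j < n \<Longrightarrow> \<exists>h\<in>F. \<forall>(A, B)\<in>mm_domain n. h (A, B) = (A * B) $$ (i, j)"
  shows "mm_computable n q"
proof -
  have "straight_line (mm_domain n) (mm_inputs n) (mm_inputs n \<union> range (\<lambda>c x. c)) 0"
    by (rule straight_line.start)
  from slp_extendsE[OF assms(1) this]
  obtain S where "F \<subseteq> S" "straight_line (mm_domain n) (mm_inputs n) S (0 + q)"
    using Un_upper1 .
  then show ?thesis
    unfolding mm_computable_def using assms(2) by (intro exI[of _ S]) (simp, blast)
qed

text \<open>
  A multiplication program may be applied to any two matrices whose entries have been computed.
\<close>

lemma slp_extends_mm: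
  assumes "mm_computable n q"
    and "\<And>i j. i < n \<Longrightarrow> j < n \<Longrightarrow> (\<lambda>x. P x $$ (i, j)) \<in> S\<^sub>0 \<and> (\<lambda>x. Q x $$ (i, j)) \<in> S\<^sub>0"
    and "\<And>x. x \<in> D \<Longrightarrow> P x \<in> carrier_mat n n \<and> Q x \<in> carrier_mat n n"
  shows "\<exists>F. slp_extends D I S\<^sub>0 F q \<and>
    (\<forall>i<n. \<forall>j<n. \<exists>h\<in>F. \<forall>x\<in>D. h x = (P x * Q x) $$ (i, j))"
proof -
  from assms(1) obtain S where S: "straight_line (mm_domain n) (mm_inputs n) S q"
    "\<And>i j. i < n \<Longrightarrow> j < n \<Longrightarrow> \<exists>h\<in>S. \<forall>(A, B)\<in>mm_domain n. h (A, B) = (A * B) $$ (i, j)"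
    unfolding mm_computable_def by blast
  let ?\<phi> = "\<lambda>x. (P x, Q x)"
  have "slp_extends D I ((\<lambda>h x. h (?\<phi> x)) ` mm_inputs n) ((\<lambda>h x. h (?\<phi> x)) ` S) q"
    by (rule slp_extends_compose[OF S(1)]) (use assms(3) in \<open>auto simp: mm_domain_def\<close>)
  moreover have "(\<lambda>h x. h (?\<phi> x)) ` mm_inputs n \<subseteq> S\<^sub>0"
    using assms(2) unfolding mm_inputs_eq by auto
  ultimately have "slp_extends D I S\<^sub>0 ((\<lambda>h x. h (?\<phi> x)) ` S) q"
    by (rule slp_extends_mono) auto
  moreover have "\<exists>h\<in>(\<lambda>h x. h (?\<phi> x)) ` S. \<forall>x\<in>D. h x = (P x * Q x) $$ (i, j)"
    if ij: "i < n" "j < n" for i j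
  proof -
    obtain h where h: "h \<in> S" "\<And>A B. (A, B) \<in> mm_domain n \<Longrightarrow> h (A, B) = (A * B) $$ (i, j)"
      using S(2)[OF ij] by auto
    have "\<forall>x\<in>D. h (?\<phi> x) = (P x * Q x) $$ (i, j)"
      using assms(3) by (auto intro!: h(2) simp: mm_domain_def)
    then show ?thesis using h(1) by auto
  qed
  ultimately show ?thesis by blast
qed

lemma mm_computable_mono:
  assumes "mm_computable N q" "n \<le> N"
  shows "mm_computable n q"
proof -
  \<comment> \<open>The matrices are padded by zeros, which are constants and therefore free of charge.\<close>
  define pad where "pad A = mat N N (\<lambda>(i, j). if i < n \<and> j < n then A $$ (i, j) else 0)"
    for A :: "complex mat"
  let ?S = "mm_inputs n \<union> range (\<lambda>c x. c)"
  have in_S: "(\<lambda>x. pad (fst x) $$ (i, j)) \<in> ?S \<and> (\<lambda>x. pad (snd x) $$ (i, j)) \<in> ?S"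
    if "i < N" "j < N" for i j
  proof (cases "i < n \<and> j < n")
    case True
    then show ?thesis using that unfolding pad_def mm_inputs_eq by force
  qed (use that in \<open>auto simp: pad_def\<close>)
  obtain F where F: "slp_extends (mm_domain n) (mm_inputs n) ?S F q"
    "\<And>i j. i < N \<Longrightarrow> j < N \<Longrightarrow>
       \<exists>h\<in>F. \<forall>x\<in>mm_domain n. h x = (pad (fst x) * pad (snd x)) $$ (i, j)"
    using slp_extends_mm[OF assms(1), of "\<lambda>x. pad (fst x)" ?S "\<lambda>x. pad (snd x)"
        "mm_domain n" "mm_inputs n"] in_S
    by (auto simp: pad_def)
  have "slp_extends (mm_domain n) (mm_inputs n) (mm_inputs n) (range (\<lambda>c x. c)) 0"
    by (intro slp_extendsI) (auto intro: straight_line_const)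
  from slp_extends_trans[OF this F(1)]
  have ext: "slp_extends (mm_domain n) (mm_inputs n) (mm_inputs n) F q"
    by (auto intro: slp_extends_mono)
  have pad_mult: "(pad A * pad B) $$ (i, j) = (A * B) $$ (i, j)"
    if "A \<in> carrier_mat n n" "B \<in> carrier_mat n n" "i < n" "j < n" for A B i j
  proof -
    have "(pad A * pad B) $$ (i, j)
        = (\<Sum>k<N. if k \<in> {..<n} then A $$ (i, k) * B $$ (k, j) else 0)"
      using that assms(2) unfolding pad_def
      by (auto simp: scalar_prod_def atLeast0LessThan intro!: sum.cong)
    also have "\<dots> = (\<Sum>k<n. A $$ (i, k) * B $$ (k, j))"
      using assms(2) by (subst sum.inter_restrict[symmetric]) (auto intro!: sum.cong)
    also have "\<dots> = (A * B) $$ (i, j)"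
      using that by (auto simp: scalar_prod_def atLeast0LessThan)
    finally show ?thesis .
  qed
  show ?thesis
  proof (rule mm_computableI[OF ext])
    fix i j assume ij: "i < n" "j < n"
    then obtain h where "h \<in> F"
      "\<And>x. x \<in> mm_domain n \<Longrightarrow> h x = (pad (fst x) * pad (snd x)) $$ (i, j)"
      using F(2)[of i j] assms(2) by (meson order_less_le_trans)
    then show "\<exists>h\<in>F. \<forall>(A, B)\<in>mm_domain n. h (A, B) = (A * B) $$ (i, j)"
      using ij pad_mult by (intro bexI[of _ h]) (auto simp: mm_domain_def)
  qed
qed

section \<open>The rank of the matrix multiplication tensor\<close>

text \<open>
  A decomposition of length \<open>r\<close> of the tensor of the multiplication of \<open>m \<times> n\<close> by \<open>n \<times> p\<close> matrices.
  The third factor is indexed by the position in the product and not, as in the cyclically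
  symmetric convention, by its transpose.
\<close>

definition mm_decomposition :: "nat \<Rightarrow> nat \<Rightarrow> nat \<Rightarrow> nat \<Rightarrow> (nat \<Rightarrow> nat \<Rightarrow> nat \<Rightarrow> complex) \<Rightarrow>
    (nat \<Rightarrow> nat \<Rightarrow> nat \<Rightarrow> complex) \<Rightarrow> (nat \<Rightarrow> nat \<Rightarrow> nat \<Rightarrow> complex) \<Rightarrow> bool" where
  "mm_decomposition m n p r u v w \<longleftrightarrow>
     (\<forall>i<m. \<forall>j<n. \<forall>j'<n. \<forall>k<p. \<forall>i'<m. \<forall>k'<p.
       (\<Sum>t<r. u t i j * v t j' k * w t i' k') = of_bool (i = i' \<and> j = j' \<and> k = k'))"

text \<open>
  \<open>mm_rank_le m n p r\<close>: the rank of \<open>\<langle>m, n, p\<rangle>\<close> is at most \<open>r\<close>.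
\<close>

definition mm_rank_le :: "nat \<Rightarrow> nat \<Rightarrow> nat \<Rightarrow> nat \<Rightarrow> bool" where
  "mm_rank_le m n p r \<longleftrightarrow> (\<exists>u v w. mm_decomposition m n p r u v w)"

lemma mm_decompositionI:
  assumes "\<And>i j j' k i' k'. i < m \<Longrightarrow> j < n \<Longrightarrow> j' < n \<Longrightarrow> k < p \<Longrightarrow> i' < m \<Longrightarrow> k' < p \<Longrightarrow>
     (\<Sum>t<r. u t i j * v t j' k * w t i' k') = of_bool (i = i' \<and> j = j' \<and> k = k')"
  shows "mm_decomposition m n p r u v w"
  unfolding mm_decomposition_def using assms by (intro allI impI)

lemma mm_decompositionD:
  assumes "mm_decomposition m n p r u v w" "i < m" "j < n" "j' < n" "k < p" "i' < m" "k' < p"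
  shows "(\<Sum>t<r. u t i j * v t j' k * w t i' k') = of_bool (i = i' \<and> j = j' \<and> k = k')"
  using assms unfolding mm_decomposition_def by simp

lemma sum_if_const: "(\<Sum>x\<in>A. if P then f x else 0) = (if P then \<Sum>x\<in>A. f x else (0 :: complex))"
  by simp

lemma sum_kronecker:
  fixes g :: "nat \<Rightarrow> nat \<Rightarrow> nat \<Rightarrow> nat \<Rightarrow> nat \<Rightarrow> nat \<Rightarrow> complex"
  shows "(\<Sum>a<m. \<Sum>b<n. \<Sum>b'<n. \<Sum>c<p. \<Sum>a'<m. \<Sum>c'<p.
            if a = a' \<and> b = b' \<and> c = c' then g a b b' c a' c' else 0)
       = (\<Sum>a<m. \<Sum>b<n. \<Sum>c<p. g a b b c a c)"
proof -
  have split: "(if P \<and> Q \<and> R then x else (0::complex))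
      = (if Q then if P then if R then x else 0 else 0 else 0)" for P Q R x
    by simp
  show ?thesis
    unfolding split sum_if_const by (simp add: sum.delta sum.delta')
qed

text \<open>
  Contracting both sides of a rank decomposition with arbitrary matrices; this is how the
  decompositions are used.
\<close>

lemma trilinear_identity:
  assumes "mm_decomposition m n p r u v w"
  shows "(\<Sum>t<r. (\<Sum>i<m. \<Sum>j<n. u t i j * \<alpha> i j) * (\<Sum>j<n. \<Sum>k<p. v t j k * \<beta> j k)
            * (\<Sum>i<m. \<Sum>k<p. w t i k * \<gamma> i k))
       = (\<Sum>i<m. \<Sum>j<n. \<Sum>k<p. \<alpha> i j * \<beta> j k * \<gamma> i k)"
proof -
  have prod2: "(\<Sum>i<a. \<Sum>j<b. x i j) * (\<Sum>k<c. \<Sum>l<d. y k l)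
      = (\<Sum>i<a. \<Sum>j<b. \<Sum>k<c. \<Sum>l<d. x i j * y k l)"
    for a b c d :: nat and x y :: "nat \<Rightarrow> nat \<Rightarrow> complex"
    by (simp only: sum_distrib_right) (simp only: sum_distrib_left)
  let ?g = "\<lambda>i j j' k i' k'. \<alpha> i j * \<beta> j' k * \<gamma> i' k'"
  have "(\<Sum>t<r. (\<Sum>i<m. \<Sum>j<n. u t i j * \<alpha> i j) * (\<Sum>j<n. \<Sum>k<p. v t j k * \<beta> j k)
            * (\<Sum>i<m. \<Sum>k<p. w t i k * \<gamma> i k))
      = (\<Sum>t<r. \<Sum>i<m. \<Sum>j<n. \<Sum>j'<n. \<Sum>k<p. \<Sum>i'<m. \<Sum>k'<p.
            (u t i j * v t j' k * w t i' k') * ?g i j j' k i' k')"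
    by (intro sum.cong refl, subst prod2, simp only: sum_distrib_right)
       (simp only: sum_distrib_left mult_ac)
  also have "\<dots> = (\<Sum>i<m. \<Sum>j<n. \<Sum>j'<n. \<Sum>k<p. \<Sum>i'<m. \<Sum>k'<p.
            (\<Sum>t<r. u t i j * v t j' k * w t i' k') * ?g i j j' k i' k')"
    by (simp add: sum_distrib_right sum.swap[where A = "{..<r}"])
  also have "\<dots> = (\<Sum>i<m. \<Sum>j<n. \<Sum>j'<n. \<Sum>k<p. \<Sum>i'<m. \<Sum>k'<p.
            if i = i' \<and> j = j' \<and> k = k' then ?g i j j' k i' k' else 0)"
    by (intro sum.cong refl) (simp add: mm_decompositionD[OF assms])
  also have "\<dots> = (\<Sum>i<m. \<Sum>j<n. \<Sum>k<p. \<alpha> i j * \<beta> j k * \<gamma> i k)"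
    by (rule sum_kronecker)
  finally show ?thesis .
qed

lemma sum_blocks: "(\<Sum>l<M * n. g l) = (\<Sum>b<M. \<Sum>j<n. g (b * n + j))"
  for g :: "nat \<Rightarrow> 'a::comm_monoid_add"
proof -
  have "(\<Sum>j<n. g (b * n + j)) = sum g {b * n..<b * n + n}" for b
    using sum.shift_bounds_nat_ivl[of g 0 "b * n" n] by (simp add: atLeast0LessThan add.commute)
  then show ?thesis by (simp add: sum.nat_group)
qed

lemma block_index_less: "a < M \<Longrightarrow> i < n \<Longrightarrow> a * n + i < M * (n :: nat)"
  by (metis add.commute mult_less_mono1 div_less_iff_less_mult div_mult_self3 div_less
      gr_implies_not_zero add_0 not_gr0)

section \<open>From programs to tensor rank\<close>

text \<open>
  Linear forms in the entries of \<open>(A, B)\<close>, represented by the one consequence of linearity that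
  matters below: the value at \<open>(A, B)\<close> is the sum of the values at \<open>(A, 0)\<close> and \<open>(0, B)\<close>.
\<close>

definition lin_form :: "nat \<Rightarrow> (complex mat \<times> complex mat \<Rightarrow> complex) \<Rightarrow> bool" where
  "lin_form n L \<longleftrightarrow> (\<forall>A\<in>carrier_mat n n. \<forall>B\<in>carrier_mat n n. L (A, B) = L (A, 0\<^sub>m n n) + L (0\<^sub>m n n, B))"

text \<open>
  \<open>has_jet n h c L Q\<close>: on every line through the origin of the domain, \<open>h\<close> is a polynomial in the
  parameter of the line, and \<open>c\<close>, \<open>L\<close> and \<open>Q\<close> are its first three coefficients.
\<close>

definition has_jet :: "nat \<Rightarrow> (complex mat \<times> complex mat \<Rightarrow> complex) \<Rightarrow> complex \<Rightarrow>
    (complex mat \<times> complex mat \<Rightarrow> complex) \<Rightarrow> (complex mat \<times> complex mat \<Rightarrow> complex) \<Rightarrow> bool" where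
  "has_jet n h c L Q \<longleftrightarrow> (\<forall>A\<in>carrier_mat n n. \<forall>B\<in>carrier_mat n n. \<exists>P.
     (\<forall>t. h (t \<cdot>\<^sub>m A, t \<cdot>\<^sub>m B) = poly P t) \<and>
     coeff P 0 = c \<and> coeff P 1 = L (A, B) \<and> coeff P 2 = Q (A, B))"

text \<open>
  The linear span of the products \<open>F r * G r\<close>, \<open>r < k\<close>.
\<close>

definition product_span ::
  "nat \<Rightarrow> (nat \<Rightarrow> 'x \<Rightarrow> complex) \<Rightarrow> (nat \<Rightarrow> 'x \<Rightarrow> complex) \<Rightarrow> ('x \<Rightarrow> complex) set" where
  "product_span k F G = {Q. \<exists>w. Q = (\<lambda>x. \<Sum>r<k. w r * (F r x * G r x))}"

lemma product_span_add:
  assumes "Q \<in> product_span k F G" "Q' \<in> product_span k F G"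
  shows "(\<lambda>x. Q x + Q' x) \<in> product_span k F G"
proof -
  obtain w w' where "Q = (\<lambda>x. \<Sum>r<k. w r * (F r x * G r x))"
    "Q' = (\<lambda>x. \<Sum>r<k. w' r * (F r x * G r x))"
    using assms unfolding product_span_def by blast
  then have "(\<lambda>x. Q x + Q' x) = (\<lambda>x. \<Sum>r<k. (w r + w' r) * (F r x * G r x))"
    by (simp add: sum.distrib distrib_right)
  then show ?thesis unfolding product_span_def by (auto intro!: exI[of _ "\<lambda>r. w r + w' r"])
qed

lemma product_span_scale:
  assumes "Q \<in> product_span k F G"
  shows "(\<lambda>x. a * Q x) \<in> product_span k F G"
proof -
  obtain w where "Q = (\<lambda>x. \<Sum>r<k. w r * (F r x * G r x))"
    using assms unfolding product_span_def by blast
  then have "(\<lambda>x. a * Q x) = (\<lambda>x. \<Sum>r<k. (a * w r) * (F r x * G r x))"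
    by (simp add: sum_distrib_left mult.assoc)
  then show ?thesis unfolding product_span_def by (auto intro!: exI[of _ "\<lambda>r. a * w r"])
qed

lemma product_span_zero: "(\<lambda>x. 0) \<in> product_span k F G"
  unfolding product_span_def by (auto intro!: exI[of _ "\<lambda>r. 0"])

lemma product_span_extend:
  assumes "Q \<in> product_span k F G"
  shows "Q \<in> product_span (Suc k) (F(k := f)) (G(k := g))"
proof -
  obtain w where "Q = (\<lambda>x. \<Sum>r<k. w r * (F r x * G r x))"
    using assms unfolding product_span_def by blast
  then have "Q = (\<lambda>x. \<Sum>r<Suc k. (w(k := 0)) r * ((F(k := f)) r x * (G(k := g)) r x))"
    by simp
  then show ?thesis unfolding product_span_def by blast
qed

lemma product_span_new: "(\<lambda>x. f x * g x) \<in> product_span (Suc k) (F(k := f)) (G(k := g))"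
  unfolding product_span_def by (auto intro!: exI[of _ "\<lambda>r. of_bool (r = k)"])

lemma lin_form_combine:
  assumes "lin_form n L" "lin_form n L'"
  shows "lin_form n (\<lambda>x. a * L x + b * L' x)"
  unfolding lin_form_def
proof (intro ballI)
  fix A B :: "complex mat" assume "A \<in> carrier_mat n n" "B \<in> carrier_mat n n"
  then have "L (A, B) = L (A, 0\<^sub>m n n) + L (0\<^sub>m n n, B)"
    and "L' (A, B) = L' (A, 0\<^sub>m n n) + L' (0\<^sub>m n n, B)"
    using assms unfolding lin_form_def by blast+
  then show "a * L (A, B) + b * L' (A, B) = a * L (A, 0\<^sub>m n n) + b * L' (A, 0\<^sub>m n n)
      + (a * L (0\<^sub>m n n, B) + b * L' (0\<^sub>m n n, B))"
    by (simp add: distrib_left)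
qed

lemma has_jet_combine:
  assumes "has_jet n f c L Q" "has_jet n g c' L' Q'"
  shows "has_jet n (\<lambda>x. a * f x + b * g x) (a * c + b * c')
    (\<lambda>x. a * L x + b * L' x) (\<lambda>x. a * Q x + b * Q' x)"
  unfolding has_jet_def
proof (intro ballI)
  fix A B :: "complex mat" assume "A \<in> carrier_mat n n" "B \<in> carrier_mat n n"
  then obtain P P' where
    "\<And>t. f (t \<cdot>\<^sub>m A, t \<cdot>\<^sub>m B) = poly P t" "coeff P 0 = c" "coeff P 1 = L (A, B)" "coeff P 2 = Q (A, B)"
    "\<And>t. g (t \<cdot>\<^sub>m A, t \<cdot>\<^sub>m B) = poly P' t" "coeff P' 0 = c'" "coeff P' 1 = L' (A, B)"
    "coeff P' 2 = Q' (A, B)"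
    using assms unfolding has_jet_def by metis
  then show "\<exists>P. (\<forall>t. a * f (t \<cdot>\<^sub>m A, t \<cdot>\<^sub>m B) + b * g (t \<cdot>\<^sub>m A, t \<cdot>\<^sub>m B) = poly P t) \<and>
      coeff P 0 = a * c + b * c' \<and> coeff P 1 = a * L (A, B) + b * L' (A, B) \<and>
      coeff P 2 = a * Q (A, B) + b * Q' (A, B)"
    by (intro exI[of _ "Polynomial.smult a P + Polynomial.smult b P'"]) auto
qed

lemma has_jet_mult:
  assumes "has_jet n f c L Q" "has_jet n g c' L' Q'"
  shows "has_jet n (\<lambda>x. f x * g x) (c * c') (\<lambda>x. c * L' x + c' * L x)
    (\<lambda>x. c * Q' x + c' * Q x + L x * L' x)"
  unfolding has_jet_def
proof (intro ballI)
  fix A B :: "complex mat" assume "A \<in> carrier_mat n n" "B \<in> carrier_mat n n"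
  then obtain P P' where
    "\<And>t. f (t \<cdot>\<^sub>m A, t \<cdot>\<^sub>m B) = poly P t" "coeff P 0 = c" "coeff P 1 = L (A, B)" "coeff P 2 = Q (A, B)"
    "\<And>t. g (t \<cdot>\<^sub>m A, t \<cdot>\<^sub>m B) = poly P' t" "coeff P' 0 = c'" "coeff P' 1 = L' (A, B)"
    "coeff P' 2 = Q' (A, B)"
    using assms unfolding has_jet_def by metis
  then show "\<exists>P. (\<forall>t. f (t \<cdot>\<^sub>m A, t \<cdot>\<^sub>m B) * g (t \<cdot>\<^sub>m A, t \<cdot>\<^sub>m B) = poly P t) \<and>
      coeff P 0 = c * c' \<and> coeff P 1 = c * L' (A, B) + c' * L (A, B) \<and>
      coeff P 2 = c * Q' (A, B) + c' * Q (A, B) + L (A, B) * L' (A, B)"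
    by (intro exI[of _ "P * P'"]) (auto simp: coeff_mult eval_nat_numeral)
qed

text \<open>
  Divisions contribute nothing: along each line the denominator is a polynomial without zeros,
  hence constant.
\<close>

lemma has_jet_divide:
  assumes "has_jet n f c L Q" "has_jet n g c' L' Q'" and nz: "\<forall>x\<in>mm_domain n. g x \<noteq> 0"
  shows "has_jet n (\<lambda>x. f x / g x) (1 / c' * c) (\<lambda>x. 1 / c' * L x) (\<lambda>x. 1 / c' * Q x)"
  unfolding has_jet_def
proof (intro ballI)
  fix A B :: "complex mat" assume AB: "A \<in> carrier_mat n n" "B \<in> carrier_mat n n"
  then obtain P P' where P:
    "\<And>t. f (t \<cdot>\<^sub>m A, t \<cdot>\<^sub>m B) = poly P t" "coeff P 0 = c" "coeff P 1 = L (A, B)" "coeff P 2 = Q (A, B)"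
    "\<And>t. g (t \<cdot>\<^sub>m A, t \<cdot>\<^sub>m B) = poly P' t" "coeff P' 0 = c'"
    using assms(1,2) unfolding has_jet_def by metis
  have "poly P' t \<noteq> 0" for t
    using nz AB unfolding P(5)[symmetric] mm_domain_def by auto
  then have "constant (poly P')"
    using fundamental_theorem_of_algebra by blast
  then have "poly P' t = c'" for t
    using P(6) unfolding constant_def poly_0_coeff_0[symmetric] by blast
  with P show "\<exists>P. (\<forall>t. f (t \<cdot>\<^sub>m A, t \<cdot>\<^sub>m B) / g (t \<cdot>\<^sub>m A, t \<cdot>\<^sub>m B) = poly P t) \<and>
      coeff P 0 = 1 / c' * c \<and> coeff P 1 = 1 / c' * L (A, B) \<and> coeff P 2 = 1 / c' * Q (A, B)"
    by (intro exI[of _ "Polynomial.smult (1 / c') P"]) auto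
qed

text \<open>
  Additions, subtractions and divisions stay in the span of the products used so far; a
  multiplication enlarges it by the product of the two linear parts.
\<close>

lemma straight_line_jets:
  assumes "straight_line (mm_domain n) (mm_inputs n) S k"
  shows "\<exists>F G. (\<forall>r<k. lin_form n (F r) \<and> lin_form n (G r)) \<and>
    (\<forall>h\<in>S. \<exists>c L Q. lin_form n L \<and> Q \<in> product_span k F G \<and> has_jet n h c L Q)"
    (is "?goal S k")
proof -
  have step: "?goal (insert h S) (Suc k)"
    if ih: "?goal S k" and new: "\<And>F G. (\<forall>h\<in>S. \<exists>c L Q. lin_form n L \<and> Q \<in> product_span k F G \<and>
        has_jet n h c L Q) \<Longrightarrow> \<exists>f\<^sub>0 g\<^sub>0 c L Q. lin_form n f\<^sub>0 \<and> lin_form n g\<^sub>0 \<and> lin_form n L \<and>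
        Q \<in> product_span (Suc k) (F(k := f\<^sub>0)) (G(k := g\<^sub>0)) \<and> has_jet n h c L Q" for S h k
  proof -
    obtain F G where lin: "\<forall>r<k. lin_form n (F r) \<and> lin_form n (G r)"
      and old: "\<forall>h\<in>S. \<exists>c L Q. lin_form n L \<and> Q \<in> product_span k F G \<and> has_jet n h c L Q"
      using ih by iprover
    obtain f\<^sub>0 g\<^sub>0 c L Q where 0: "lin_form n f\<^sub>0" "lin_form n g\<^sub>0"
      "lin_form n L" "Q \<in> product_span (Suc k) (F(k := f\<^sub>0)) (G(k := g\<^sub>0))" "has_jet n h c L Q"
      using new[OF old] by blast
    have "\<forall>r<Suc k. lin_form n ((F(k := f\<^sub>0)) r) \<and> lin_form n ((G(k := g\<^sub>0)) r)"
      using lin 0 by (simp add: less_Suc_eq)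
    moreover have "\<forall>h\<in>insert h S. \<exists>c L Q. lin_form n L \<and>
        Q \<in> product_span (Suc k) (F(k := f\<^sub>0)) (G(k := g\<^sub>0)) \<and> has_jet n h c L Q"
    proof (rule ballI, elim insertE)
      fix h' assume "h' \<in> S"
      then obtain c' L' Q' where "lin_form n L'" "Q' \<in> product_span k F G" "has_jet n h' c' L' Q'"
        using old by meson
      then show "\<exists>c L Q. lin_form n L \<and>
          Q \<in> product_span (Suc k) (F(k := f\<^sub>0)) (G(k := g\<^sub>0)) \<and> has_jet n h' c L Q"
        using product_span_extend by blast
    qed (use 0 in blast)
    ultimately show ?thesis by blast
  qed
  have combine: "\<exists>f\<^sub>0 g\<^sub>0 c L Q. lin_form n f\<^sub>0 \<and> lin_form n g\<^sub>0 \<and> lin_form n L \<and>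
      Q \<in> product_span (Suc k) (F(k := f\<^sub>0)) (G(k := g\<^sub>0)) \<and> has_jet n (\<lambda>x. a * f x + b * g x) c L Q"
    if S: "\<forall>h\<in>S. \<exists>c L Q. lin_form n L \<and> Q \<in> product_span k F G \<and> has_jet n h c L Q"
      and "f \<in> S" "g \<in> S" for S k F G f g a b
  proof -
    obtain c L Q where f: "lin_form n L" "Q \<in> product_span k F G" "has_jet n f c L Q"
      using S \<open>f \<in> S\<close> by meson
    obtain c' L' Q' where g: "lin_form n L'" "Q' \<in> product_span k F G" "has_jet n g c' L' Q'"
      using S \<open>g \<in> S\<close> by meson
    have "(\<lambda>x. a * Q x + b * Q' x) \<in> product_span (Suc k) (F(k := L)) (G(k := L))"
      by (intro product_span_extend product_span_add product_span_scale f g)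
    then show ?thesis
      using f(1) lin_form_combine[OF f(1) g(1), of a b] has_jet_combine[OF f(3) g(3), of a b] by blast
  qed
  from assms show ?thesis
  proof (induction rule: straight_line.induct)
    case start
    have "\<exists>c L Q. lin_form n L \<and> Q \<in> product_span 0 F G \<and> has_jet n h c L Q"
      if "h \<in> mm_inputs n \<union> range (\<lambda>c x. c)" for h F G
    proof -
      from that consider "h \<in> mm_inputs n" | c where "h = (\<lambda>x. c)" by blast
      then show ?thesis
      proof cases
        case 1
        have "\<exists>P. (\<forall>t. h (t \<cdot>\<^sub>m A, t \<cdot>\<^sub>m B) = poly P t) \<and> coeff P 0 = 0 \<and> coeff P 1 = h (A, B)
            \<and> coeff P 2 = 0" if "A \<in> carrier_mat n n" "B \<in> carrier_mat n n" for A B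
          using 1 that by (intro exI[of _ "[:0, h (A, B):]"])
            (auto simp: mm_inputs_eq eval_nat_numeral)
        then have "has_jet n h 0 h (\<lambda>x. 0)" unfolding has_jet_def by blast
        moreover have "lin_form n h" using 1 unfolding lin_form_def mm_inputs_eq by auto
        ultimately show ?thesis using product_span_zero by blast
      next
        case 2
        then have "has_jet n h c (\<lambda>x. 0) (\<lambda>x. 0)" unfolding has_jet_def
          by (auto intro!: exI[of _ "[:c:]"] simp: eval_nat_numeral)
        moreover have "lin_form n (\<lambda>x. 0)" unfolding lin_form_def by simp
        ultimately show ?thesis using product_span_zero by blast
      qed
    qed
    then show ?case by simp
  next
    case (add S k f g)
    show ?case
      by (rule step[OF add.IH]) (use combine[where a = 1 and b = 1] add.hyps in simp)
  next
    case (sub S k f g)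
    show ?case
      by (rule step[OF sub.IH]) (use combine[where a = 1 and b = "- 1"] sub.hyps in simp)
  next
    case (mult S k f g)
    show ?case
    proof (rule step[OF mult.IH])
      fix F G assume S: "\<forall>h\<in>S. \<exists>c L Q. lin_form n L \<and> Q \<in> product_span k F G \<and> has_jet n h c L Q"
      obtain c L Q where f: "lin_form n L" "Q \<in> product_span k F G" "has_jet n f c L Q"
        using S mult.hyps by meson
      obtain c' L' Q' where g: "lin_form n L'" "Q' \<in> product_span k F G" "has_jet n g c' L' Q'"
        using S mult.hyps by meson
      have "(\<lambda>x. c * Q' x + c' * Q x + L x * L' x)
          \<in> product_span (Suc k) (F(k := L)) (G(k := L'))"
        by (intro product_span_add product_span_new product_span_extend product_span_scale f g)
      then show "\<exists>f\<^sub>0 g\<^sub>0 c L Q. lin_form n f\<^sub>0 \<and> lin_form n g\<^sub>0 \<and> lin_form n L \<and>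
          Q \<in> product_span (Suc k) (F(k := f\<^sub>0)) (G(k := g\<^sub>0)) \<and> has_jet n (\<lambda>x. f x * g x) c L Q"
        using f(1) g(1) lin_form_combine[OF g(1) f(1), of c c'] has_jet_mult[OF f(3) g(3)] by blast
    qed
  next
    case (divide S k f g)
    show ?case
    proof (rule step[OF divide.IH])
      fix F G assume S: "\<forall>h\<in>S. \<exists>c L Q. lin_form n L \<and> Q \<in> product_span k F G \<and> has_jet n h c L Q"
      obtain c L Q where f: "lin_form n L" "Q \<in> product_span k F G" "has_jet n f c L Q"
        using S divide.hyps by meson
      obtain c' L' Q' where g: "has_jet n g c' L' Q'"
        using S divide.hyps by meson
      have "(\<lambda>x. 1 / c' * Q x) \<in> product_span (Suc k) (F(k := L)) (G(k := L))"
        by (intro product_span_extend product_span_scale f)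
      moreover have "lin_form n (\<lambda>x. 1 / c' * L x)"
        using lin_form_combine[OF f(1) f(1), of "1 / c'" 0] by simp
      ultimately show "\<exists>f\<^sub>0 g\<^sub>0 c L Q. lin_form n f\<^sub>0 \<and> lin_form n g\<^sub>0 \<and> lin_form n L \<and>
          Q \<in> product_span (Suc k) (F(k := f\<^sub>0)) (G(k := g\<^sub>0)) \<and> has_jet n (\<lambda>x. f x / g x) c L Q"
        using f(1) has_jet_divide[OF f(3) g divide.hyps(4)] by blast
    qed
  qed
qed

text \<open>
  Only the coefficients of degree two of the computed functions matter, and \<open>k\<close> operations produce
  them from \<open>k\<close> products of linear forms.  Splitting every linear form according to the two matrices
  turns each such product into two products of the bilinear kind.
\<close>

lemma mm_rank_le_of_computable:
  assumes "mm_computable n k"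
  shows "mm_rank_le n n n (2 * k)"
proof -
  obtain S where S: "straight_line (mm_domain n) (mm_inputs n) S k"
    "\<And>i j. i < n \<Longrightarrow> j < n \<Longrightarrow> \<exists>h\<in>S. \<forall>(A, B)\<in>mm_domain n. h (A, B) = (A * B) $$ (i, j)"
    using assms unfolding mm_computable_def by blast
  obtain F G where lin: "\<forall>r<k. lin_form n (F r) \<and> lin_form n (G r)"
    and jets: "\<forall>h\<in>S. \<exists>c L Q. lin_form n L \<and> Q \<in> product_span k F G \<and> has_jet n h c L Q"
    using straight_line_jets[OF S(1)] by iprover
  let ?O = "0\<^sub>m n n :: complex mat"
  let ?expresses = "\<lambda>i j w. \<forall>A\<in>carrier_mat n n. \<forall>B\<in>carrier_mat n n.
      (A * B) $$ (i, j) = (\<Sum>r<k. w r * (F r (A, B) * G r (A, B)))"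
  have ex: "\<exists>w. ?expresses i j w" if ij: "i < n" "j < n" for i j
  proof -
    obtain h where h: "h \<in> S" "\<And>A B. A \<in> carrier_mat n n \<Longrightarrow> B \<in> carrier_mat n n \<Longrightarrow>
        h (A, B) = (A * B) $$ (i, j)"
      using S(2)[OF ij] unfolding mm_domain_def by auto
    obtain c L Q where "Q \<in> product_span k F G" and jet: "has_jet n h c L Q"
      using jets h(1) by meson
    then obtain w where Q: "Q = (\<lambda>x. \<Sum>r<k. w r * (F r x * G r x))"
      unfolding product_span_def by blast
    have "(A * B) $$ (i, j) = Q (A, B)" if AB: "A \<in> carrier_mat n n" "B \<in> carrier_mat n n" for A B
    proof -
      obtain P where P: "\<And>t. h (t \<cdot>\<^sub>m A, t \<cdot>\<^sub>m B) = poly P t" "coeff P 2 = Q (A, B)"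
        using jet AB unfolding has_jet_def by blast
      have "poly P t = poly (monom ((A * B) $$ (i, j)) 2) t" for t
        using AB ij unfolding P(1)[symmetric]
        by (simp add: h(2) poly_monom power2_eq_square mult_smult_distrib[of _ n n]
            mult_smult_assoc_mat[of _ n n])
      then have "P = monom ((A * B) $$ (i, j)) 2"
        by (metis poly_eq_poly_eq_iff ext)
      with P(2) show ?thesis by simp
    qed
    then show ?thesis unfolding Q by blast
  qed
  define W where "W i j = (SOME w. ?expresses i j w)" for i j
  have "?expresses i j (W i j)" if "i < n" "j < n" for i j
    unfolding W_def by (rule someI_ex[OF ex[OF that]])
  then have W: "(A * B) $$ (i, j) = (\<Sum>r<k. W i j r * (F r (A, B) * G r (A, B)))"
    if "i < n" "j < n" "A \<in> carrier_mat n n" "B \<in> carrier_mat n n" for i j A B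
    using that by blast
  \<comment> \<open>Subtracting the vanishing products \<open>A * 0\<close> and \<open>0 * B\<close> leaves the mixed terms.\<close>
  have bilinear: "(A * B) $$ (i, j) = (\<Sum>r<k. W i j r * (F r (A, ?O) * G r (?O, B)))
      + (\<Sum>r<k. W i j r * (G r (A, ?O) * F r (?O, B)))"
    if ij: "i < n" "j < n" and AB: "A \<in> carrier_mat n n" "B \<in> carrier_mat n n" for i j A B
  proof -
    have "(A * B) $$ (i, j) = (A * B) $$ (i, j) - (A * ?O) $$ (i, j) - (?O * B) $$ (i, j)"
      using ij AB by simp
    also have "\<dots> = (\<Sum>r<k. W i j r * (F r (A, B) * G r (A, B))
        - W i j r * (F r (A, ?O) * G r (A, ?O)) - W i j r * (F r (?O, B) * G r (?O, B)))"
      using ij AB by (simp add: W[OF ij, symmetric] sum_subtractf)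
    also have "\<dots> = (\<Sum>r<k. W i j r * (F r (A, ?O) * G r (?O, B))
        + W i j r * (G r (A, ?O) * F r (?O, B)))"
    proof (intro sum.cong refl)
      fix r assume "r \<in> {..<k}"
      then have "F r (A, B) = F r (A, ?O) + F r (?O, B)" "G r (A, B) = G r (A, ?O) + G r (?O, B)"
        using lin AB unfolding lin_form_def by blast+
      then show "W i j r * (F r (A, B) * G r (A, B)) - W i j r * (F r (A, ?O) * G r (A, ?O))
          - W i j r * (F r (?O, B) * G r (?O, B))
          = W i j r * (F r (A, ?O) * G r (?O, B)) + W i j r * (G r (A, ?O) * F r (?O, B))"
        by (simp add: algebra_simps)
    qed
    finally show ?thesis by (simp add: sum.distrib)
  qed
  \<comment> \<open>The decomposition consists of the values of the linear forms at matrix units.\<close>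
  define E :: "nat \<Rightarrow> nat \<Rightarrow> complex mat"
    where "E i j = mat n n (\<lambda>(a, b). of_bool (a = i \<and> b = j))" for i j
  have E_carrier: "E i j \<in> carrier_mat n n" for i j unfolding E_def by simp
  have E_mult: "(E i j * E j' l) $$ (i', l') = of_bool (i = i' \<and> j = j' \<and> l = l')"
    if "i < n" "j < n" "j' < n" "l < n" "i' < n" "l' < n" for i j j' l i' l'
  proof -
    have "(E i j * E j' l) $$ (i', l')
        = (\<Sum>x<n. if x = j then of_bool (i = i' \<and> j = j' \<and> l = l') else 0)"
      using that unfolding E_def
      by (auto simp: scalar_prod_def atLeast0LessThan intro!: sum.cong)
    then show ?thesis using that by simp
  qed
  define u where "u t i j = (if t < k then F t (E i j, ?O) else G (t - k) (E i j, ?O))" for t i j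
  define v where "v t i j = (if t < k then G t (?O, E i j) else F (t - k) (?O, E i j))" for t i j
  define w where "w t i j = W i j (if t < k then t else t - k)" for t i j
  have "(\<Sum>t<2 * k. u t i j * v t j' l * w t i' l') = of_bool (i = i' \<and> j = j' \<and> l = l')"
    if "i < n" "j < n" "j' < n" "l < n" "i' < n" "l' < n" for i j j' l i' l'
  proof -
    have "(\<Sum>t<2 * k. u t i j * v t j' l * w t i' l')
        = (E i j * E j' l) $$ (i', l')"
      using that unfolding sum_blocks bilinear[OF that(5,6) E_carrier E_carrier]
      by (simp add: u_def v_def w_def numeral_2_eq_2 mult_ac)
    then show ?thesis using E_mult that by simp
  qed
  then show ?thesis unfolding mm_rank_le_def by (blast intro: mm_decompositionI)
qed

section \<open>Basic properties of the rank\<close>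

lemma bilinear_identity:
  assumes uvw: "mm_decomposition m n p r u v w"
    and "a < m" "c < p"
  shows "(\<Sum>t<r. w t a c * ((\<Sum>i<m. \<Sum>j<n. u t i j * \<alpha> i j) * (\<Sum>j<n. \<Sum>k<p. v t j k * \<beta> j k)))
       = (\<Sum>j<n. \<alpha> a j * \<beta> j c)"
proof -
  let ?\<gamma> = "\<lambda>i k. if i = a then if k = c then 1 else 0 else (0 :: complex)"
  have pick: "(\<Sum>i<m. \<Sum>k<p. x i k * ?\<gamma> i k) = x a c" for x :: "nat \<Rightarrow> nat \<Rightarrow> complex"
    using assms(2,3) by (simp add: if_distrib[of "\<lambda>y. z * y" for z] sum_if_const cong: if_cong)
  have "(\<Sum>i<m. \<Sum>j<n. \<Sum>k<p. \<alpha> i j * \<beta> j k * ?\<gamma> i k) = (\<Sum>j<n. \<Sum>i<m. \<Sum>k<p. \<alpha> i j * \<beta> j k * ?\<gamma> i k)"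
    by (rule sum.swap)
  also have "\<dots> = (\<Sum>j<n. \<alpha> a j * \<beta> j c)"
    unfolding pick[where x = "\<lambda>i k. \<alpha> i _ * \<beta> _ k"] ..
  finally show ?thesis
    using trilinear_identity[OF uvw, of \<alpha> \<beta> ?\<gamma>] unfolding pick by (simp add: mult_ac)
qed

text \<open>
  For fixed \<open>k = k' = 0\<close> a decomposition exhibits the identity matrix of size \<open>n\<^sup>2\<close> as a product
  through an \<open>r\<close>-dimensional space.
\<close>

lemma mm_rank_lower_bound:
  assumes "mm_rank_le n n n r"
  shows "n\<^sup>2 \<le> r"
proof (rule ccontr)
  assume "\<not> n\<^sup>2 \<le> r"
  define N where "N = n * n"
  have N: "r < N" "n > 0" using \<open>\<not> n\<^sup>2 \<le> r\<close> by (auto simp: N_def power2_eq_square intro: Nat.gr0I)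
  obtain u v w where uvw: "mm_decomposition n n n r u v w"
    using assms(1) unfolding mm_rank_le_def by blast
  \<comment> \<open>The two factors are padded to square matrices; as \<open>r < N\<close>, row \<open>r\<close> of \<open>B\<close> is zero.\<close>
  define A where "A = mat N N (\<lambda>(x, t). if t < r then u t (x div n) (x mod n) else 0)"
  define B where "B = mat N N (\<lambda>(t, y). if t < r then v t (y mod n) 0 * w t (y div n) 0 else 0)"
  have AB: "A \<in> carrier_mat N N" "B \<in> carrier_mat N N" unfolding A_def B_def by simp_all
  have "A * B = 1\<^sub>m N"
  proof (rule eq_matI)
    fix x y assume "x < dim_row (1\<^sub>m N :: complex mat)" "y < dim_col (1\<^sub>m N :: complex mat)"
    then have xy: "x < N" "y < N" by simp_all
    then have lt: "x div n < n" "y div n < n"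
      by (simp_all add: N_def less_mult_imp_div_less)
    have "(A * B) $$ (x, y) = (\<Sum>t<N. (if t < r then u t (x div n) (x mod n) else 0)
        * (if t < r then v t (y mod n) 0 * w t (y div n) 0 else 0))"
      using xy unfolding A_def B_def
      by (auto simp: scalar_prod_def atLeast0LessThan intro!: sum.cong)
    also have "\<dots> = (\<Sum>t<r. u t (x div n) (x mod n) * v t (y mod n) 0 * w t (y div n) 0)"
      using N by (intro sum.mono_neutral_cong_right) auto
    also have "\<dots> = of_bool (x div n = y div n \<and> x mod n = y mod n)"
      using mm_decompositionD[OF uvw] lt N by simp
    also have "x div n = y div n \<and> x mod n = y mod n \<longleftrightarrow> x = y"
      by (metis div_mult_mod_eq)
    finally show "(A * B) $$ (x, y) = 1\<^sub>m N $$ (x, y)" using xy by simp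
  qed (use AB in auto)
  from mat_mult_left_right_inverse[OF AB this] have "B * A = 1\<^sub>m N" .
  then have "(B * A) $$ (r, r) = 1" using N by simp
  moreover have "(B * A) $$ (r, r) = (\<Sum>t<N. 0)"
    using N unfolding A_def B_def
    by (auto simp: scalar_prod_def atLeast0LessThan intro!: sum.neutral)
  ultimately show False by simp
qed

lemma mm_rank_le_cycle:
  assumes "mm_rank_le m n p r"
  shows "mm_rank_le n p m r"
proof -
  obtain u v w where uvw: "mm_decomposition m n p r u v w"
    using assms(1) unfolding mm_rank_le_def by blast
  have "(\<Sum>t<r. v t j k * w t i k' * u t i' j') = of_bool (j = j' \<and> k = k' \<and> i = i')"
    if "i < m" "j < n" "j' < n" "k < p" "i' < m" "k' < p" for i i' j j' k k'
    using mm_decompositionD[OF uvw, of i' j' j k i k'] that by (auto simp: mult_ac)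
  then have "mm_decomposition n p m r v (\<lambda>t k i. w t i k) (\<lambda>t j i. u t i j)"
    by (intro mm_decompositionI) auto
  then show ?thesis unfolding mm_rank_le_def by blast
qed

text \<open>
  \<open>mm_restriction I J K S d\<close>: the matrix multiplication tensor with index sets \<open>I\<close>, \<open>J\<close>, \<open>K\<close> is a
  restriction of the direct sum over \<open>s \<in> S\<close> of the tensors of \<open>d s \<times> d s\<close> matrix multiplication.
\<close>

definition mm_restriction ::
  "'i set \<Rightarrow> 'j set \<Rightarrow> 'k set \<Rightarrow> 's set \<Rightarrow> ('s \<Rightarrow> nat) \<Rightarrow> bool" where
  "mm_restriction I J K S d \<longleftrightarrow>
    (\<exists>(U :: 's \<Rightarrow> nat \<Rightarrow> nat \<Rightarrow> 'i \<Rightarrow> 'j \<Rightarrow> complex) (V :: 's \<Rightarrow> nat \<Rightarrow> nat \<Rightarrow> 'j \<Rightarrow> 'k \<Rightarrow> complex)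
      (W :: 's \<Rightarrow> nat \<Rightarrow> nat \<Rightarrow> 'i \<Rightarrow> 'k \<Rightarrow> complex).
     \<forall>i\<in>I. \<forall>j\<in>J. \<forall>j'\<in>J. \<forall>k\<in>K. \<forall>i'\<in>I. \<forall>k'\<in>K.
      (\<Sum>s\<in>S. \<Sum>a<d s. \<Sum>b<d s. \<Sum>c<d s. U s a b i j * V s b c j' k * W s a c i' k')
        = of_bool (i = i' \<and> j = j' \<and> k = k'))"

lemma mm_restrictionI:
  fixes U V W :: "'s \<Rightarrow> nat \<Rightarrow> nat \<Rightarrow> _ \<Rightarrow> _ \<Rightarrow> complex"
  assumes "\<And>i j j' k i' k'. i \<in> I \<Longrightarrow> j \<in> J \<Longrightarrow> j' \<in> J \<Longrightarrow> k \<in> K \<Longrightarrow> i' \<in> I \<Longrightarrow> k' \<in> K \<Longrightarrow>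
      (\<Sum>s\<in>S. \<Sum>a<d s. \<Sum>b<d s. \<Sum>c<d s. U s a b i j * V s b c j' k * W s a c i' k')
        = of_bool (i = i' \<and> j = j' \<and> k = k')"
  shows "mm_restriction I J K S d"
  unfolding mm_restriction_def
  by (rule exI[of _ U], rule exI[of _ V], rule exI[of _ W]) (use assms in \<open>intro ballI\<close>)

text \<open>
  A restriction of \<open>\<langle>I, J, K\<rangle>\<close> to a direct sum of tensors \<open>\<langle>d s, d s, d s\<rangle>\<close> remains one after tensoring
  with \<open>\<langle>m, n, p\<rangle>\<close>, and the rank of a direct sum is at most the sum of the ranks.
\<close>

lemma mm_rank_le_direct_sum:
  fixes I :: "'i set" and J :: "'j set" and K :: "'k set" and S :: "'s set"
  assumes fin: "finite S" "finite I" "finite J" "finite K"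
    and "mm_restriction I J K S d"
    and rank: "\<And>s. s \<in> S \<Longrightarrow> mm_rank_le (d s * m) (d s * n) (d s * p) (\<rho> s)"
  shows "mm_rank_le (card I * m) (card J * n) (card K * p) (\<Sum>s\<in>S. \<rho> s)"
proof -
  obtain U :: "'s \<Rightarrow> nat \<Rightarrow> nat \<Rightarrow> 'i \<Rightarrow> 'j \<Rightarrow> complex"
    and V :: "'s \<Rightarrow> nat \<Rightarrow> nat \<Rightarrow> 'j \<Rightarrow> 'k \<Rightarrow> complex" and W :: "'s \<Rightarrow> nat \<Rightarrow> nat \<Rightarrow> 'i \<Rightarrow> 'k \<Rightarrow> complex"
    where restr: "\<forall>i\<in>I. \<forall>j\<in>J. \<forall>j'\<in>J. \<forall>k\<in>K. \<forall>i'\<in>I. \<forall>k'\<in>K.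
      (\<Sum>s\<in>S. \<Sum>a<d s. \<Sum>b<d s. \<Sum>c<d s. U s a b i j * V s b c j' k * W s a c i' k')
        = of_bool (i = i' \<and> j = j' \<and> k = k')"
    using assms(5) unfolding mm_restriction_def by iprover
  have "\<forall>s\<in>S. \<exists>u v w. mm_decomposition (d s * m) (d s * n) (d s * p) (\<rho> s) u v w"
    using rank unfolding mm_rank_le_def by blast
  then obtain u v w where uvw: "\<And>s. s \<in> S \<Longrightarrow>
      mm_decomposition (d s * m) (d s * n) (d s * p) (\<rho> s) (u s) (v s) (w s)"
    by metis
  obtain eI eJ eK where e: "bij_betw eI {..<card I} I" "bij_betw eJ {..<card J} J"
    "bij_betw eK {..<card K} K"
    using ex_bij_betw_nat_finite[OF fin(2)] ex_bij_betw_nat_finite[OF fin(3)]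
      ex_bij_betw_nat_finite[OF fin(4)] unfolding atLeast0LessThan by blast
  have "card (Sigma S (\<lambda>s. {..<\<rho> s})) = (\<Sum>s\<in>S. \<rho> s)"
    using fin(1) by (simp add: card_SigmaI)
  moreover have "finite (Sigma S (\<lambda>s. {..<\<rho> s}))" using fin(1) by auto
  ultimately obtain h where h: "bij_betw h {..<(\<Sum>s\<in>S. \<rho> s)} (Sigma S (\<lambda>s. {..<\<rho> s}))"
    using ex_bij_betw_nat_finite unfolding atLeast0LessThan by metis
  \<comment> \<open>An index \<open>x\<close> of the product format encodes the pair \<open>(eI (x div m), x mod m)\<close>, and an index \<open>X\<close>
    of the summand \<open>s\<close> the pair \<open>(X div m, X mod m)\<close>.  The given restriction acts on the first
    components and the identity on the second.\<close>
  define \<alpha> where "\<alpha> s x y X Y = (if X mod m = x mod m \<and> Y mod n = y mod n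
    then U s (X div m) (Y div n) (eI (x div m)) (eJ (y div n)) else 0)" for s x y X Y
  define \<beta> where "\<beta> s y z Y Z = (if Y mod n = y mod n \<and> Z mod p = z mod p
    then V s (Y div n) (Z div p) (eJ (y div n)) (eK (z div p)) else 0)" for s y z Y Z
  define \<gamma> where "\<gamma> s x z X Z = (if X mod m = x mod m \<and> Z mod p = z mod p
    then W s (X div m) (Z div p) (eI (x div m)) (eK (z div p)) else 0)" for s x z X Z
  define u' where "u' \<tau> x y = (case h \<tau> of (s, t) \<Rightarrow>
    \<Sum>X<d s * m. \<Sum>Y<d s * n. u s t X Y * \<alpha> s x y X Y)" for \<tau> x y
  define v' where "v' \<tau> y z = (case h \<tau> of (s, t) \<Rightarrow>
    \<Sum>Y<d s * n. \<Sum>Z<d s * p. v s t Y Z * \<beta> s y z Y Z)" for \<tau> y z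
  define w' where "w' \<tau> x z = (case h \<tau> of (s, t) \<Rightarrow>
    \<Sum>X<d s * m. \<Sum>Z<d s * p. w s t X Z * \<gamma> s x z X Z)" for \<tau> x z
  have "(\<Sum>\<tau><(\<Sum>s\<in>S. \<rho> s). u' \<tau> x y * v' \<tau> y' z * w' \<tau> x' z')
      = of_bool (x = x' \<and> y = y' \<and> z = z')"
    if lt: "x < card I * m" "y < card J * n" "y' < card J * n" "z < card K * p"
      "x' < card I * m" "z' < card K * p" for x y y' z x' z'
  proof -
    have pos: "m > 0" "n > 0" "p > 0"
      using lt by (auto intro: Nat.gr0I)
    have quot: "x div m < card I" "y div n < card J" "y' div n < card J" "z div p < card K"
      "x' div m < card I" "z' div p < card K"
      using lt by (simp_all add: less_mult_imp_div_less)
    have eq_iff: "a = b \<longleftrightarrow> a div q = b div q \<and> a mod q = b mod q" for a b q :: nat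
      by (metis div_mult_mod_eq)
    let ?same = "x mod m = x' mod m \<and> y mod n = y' mod n \<and> z mod p = z' mod p"
    let ?UVW = "\<lambda>s a b c. U s a b (eI (x div m)) (eJ (y div n))
      * V s b c (eJ (y' div n)) (eK (z div p)) * W s a c (eI (x' div m)) (eK (z' div p))"
    have "(\<Sum>\<tau><(\<Sum>s\<in>S. \<rho> s). u' \<tau> x y * v' \<tau> y' z * w' \<tau> x' z')
        = (\<Sum>(s, t)\<in>Sigma S (\<lambda>s. {..<\<rho> s}).
            (\<Sum>X<d s * m. \<Sum>Y<d s * n. u s t X Y * \<alpha> s x y X Y)
          * (\<Sum>Y<d s * n. \<Sum>Z<d s * p. v s t Y Z * \<beta> s y' z Y Z)
          * (\<Sum>X<d s * m. \<Sum>Z<d s * p. w s t X Z * \<gamma> s x' z' X Z))"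
      unfolding sum.reindex_bij_betw[OF h, symmetric] u'_def v'_def w'_def
      by (simp add: case_prod_unfold)
    also have "\<dots> = (\<Sum>s\<in>S. \<Sum>t<\<rho> s.
            (\<Sum>X<d s * m. \<Sum>Y<d s * n. u s t X Y * \<alpha> s x y X Y)
          * (\<Sum>Y<d s * n. \<Sum>Z<d s * p. v s t Y Z * \<beta> s y' z Y Z)
          * (\<Sum>X<d s * m. \<Sum>Z<d s * p. w s t X Z * \<gamma> s x' z' X Z))"
      using fin(1) by (simp add: sum.Sigma)
    also have "\<dots> = (\<Sum>s\<in>S. \<Sum>X<d s * m. \<Sum>Y<d s * n. \<Sum>Z<d s * p.
            \<alpha> s x y X Y * \<beta> s y' z Y Z * \<gamma> s x' z' X Z)"
      by (intro sum.cong refl trilinear_identity uvw)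
    also have "\<dots> = (\<Sum>s\<in>S. \<Sum>a<d s. \<Sum>b<d s. \<Sum>c<d s. if ?same then ?UVW s a b c else 0)"
    proof (rule sum.cong[OF refl])
      fix s assume "s \<in> S"
      have "(\<Sum>X<d s * m. \<Sum>Y<d s * n. \<Sum>Z<d s * p.
            \<alpha> s x y X Y * \<beta> s y' z Y Z * \<gamma> s x' z' X Z)
          = (\<Sum>a<d s. \<Sum>i<m. \<Sum>b<d s. \<Sum>j<n. \<Sum>c<d s. \<Sum>k<p.
              if i = x mod m then if j = y mod n then if k = z mod p
              then if ?same then ?UVW s a b c else 0 else 0 else 0 else 0)"
        unfolding sum_blocks
        by (intro sum.cong refl) (auto simp: \<alpha>_def \<beta>_def \<gamma>_def)
      also have "\<dots> = (\<Sum>a<d s. \<Sum>b<d s. \<Sum>c<d s. if ?same then ?UVW s a b c else 0)"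
        unfolding sum_if_const using pos
        by (cases "x mod m = x' mod m"; cases "y mod n = y' mod n"; cases "z mod p = z' mod p") simp_all
      finally show "(\<Sum>X<d s * m. \<Sum>Y<d s * n. \<Sum>Z<d s * p.
            \<alpha> s x y X Y * \<beta> s y' z Y Z * \<gamma> s x' z' X Z)
          = (\<Sum>a<d s. \<Sum>b<d s. \<Sum>c<d s. if ?same then ?UVW s a b c else 0)" .
    qed
    also have "\<dots> = (if ?same then \<Sum>s\<in>S. \<Sum>a<d s. \<Sum>b<d s. \<Sum>c<d s. ?UVW s a b c else 0)"
      by (cases "x mod m = x' mod m"; cases "y mod n = y' mod n"; cases "z mod p = z' mod p") simp_all
    also have "\<dots> = (if ?same then of_bool (eI (x div m) = eI (x' div m)
        \<and> eJ (y div n) = eJ (y' div n) \<and> eK (z div p) = eK (z' div p)) else 0)"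
      using restr quot e by (simp add: bij_betw_apply)
    also have "\<dots> = of_bool (x = x' \<and> y = y' \<and> z = z')"
      using quot e[THEN bij_betw_imp_inj_on] eq_iff[of x x' m] eq_iff[of y y' n] eq_iff[of z z' p]
      by (auto simp: inj_on_eq_iff)
    finally show ?thesis .
  qed
  then have "mm_decomposition (card I * m) (card J * n) (card K * p) (\<Sum>s\<in>S. \<rho> s) u' v' w'"
    by (rule mm_decompositionI)
  then show ?thesis unfolding mm_rank_le_def by blast
qed

lemma mm_rank_le_mult:
  assumes "mm_rank_le m n p r" "mm_rank_le m' n' p' r'"
  shows "mm_rank_le (m * m') (n * n') (p * p') (r * r')"
proof -
  obtain u v w where uvw: "mm_decomposition m n p r u v w"
    using assms(1) unfolding mm_rank_le_def by blast
  have "mm_restriction {..<m} {..<n} {..<p} {..<r} (\<lambda>_. 1)"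
    by (rule mm_restrictionI[where U = "\<lambda>t _ _. u t" and V = "\<lambda>t _ _. v t" and W = "\<lambda>t _ _. w t"])
       (use mm_decompositionD[OF uvw] in auto)
  then have "mm_rank_le (card {..<m} * m') (card {..<n} * n') (card {..<p} * p') (\<Sum>t<r. r')"
    by (intro mm_rank_le_direct_sum) (use assms(2) in auto)
  then show ?thesis by simp
qed

lemma mm_rank_le_cube:
  assumes "mm_rank_le m n p r"
  shows "mm_rank_le (m * n * p) (m * n * p) (m * n * p) (r ^ 3)"
  using mm_rank_le_mult[OF mm_rank_le_mult[OF assms mm_rank_le_cycle[OF assms]]
      mm_rank_le_cycle[OF mm_rank_le_cycle[OF assms]]]
  by (simp add: mult_ac power3_eq_cube)

lemma mm_rank_le_trivial: "mm_rank_le n n n (n ^ 3)"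
proof -
  let ?N = "{..<n}" and ?T = "{..<n} \<times> {..<n} \<times> {..<n}"
  have one: "{..<1} = {0 :: nat}" by auto
  have "mm_rank_le 1 1 1 1"
    unfolding mm_rank_le_def mm_decomposition_def by (intro exI[of _ "\<lambda>_ _ _. 1"]) simp
  have "mm_restriction ?N ?N ?N ?T (\<lambda>_. 1)"
  proof (rule mm_restrictionI[where U = "\<lambda>(x, y, z) _ _ i j. of_bool (i = x \<and> j = y)"
        and V = "\<lambda>(x, y, z) _ _ j k. of_bool (j = y \<and> k = z)"
        and W = "\<lambda>(x, y, z) _ _ i k. of_bool (i = x \<and> k = z)"])
    fix i j j' k i' k' assume "i \<in> ?N" "j \<in> ?N" "j' \<in> ?N" "k \<in> ?N" "i' \<in> ?N" "k' \<in> ?N"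
    then have "of_bool (i = i' \<and> j = j' \<and> k = k')
        = (\<Sum>s\<in>?T. if s = (i, j, k) then of_bool (i = i' \<and> j = j' \<and> k = k') else (0 :: complex))"
      by simp
    also have "\<dots> = (\<Sum>s\<in>?T. (case s of (x, y, z) \<Rightarrow> of_bool (i = x \<and> j = y))
        * (case s of (x, y, z) \<Rightarrow> of_bool (j' = y \<and> k = z))
        * (case s of (x, y, z) \<Rightarrow> of_bool (i' = x \<and> k' = z)))"
      by (intro sum.cong refl) auto
    finally show "(\<Sum>s\<in>?T. \<Sum>a<1::nat. \<Sum>b<1::nat. \<Sum>c<1::nat.
        (case s of (x, y, z) \<Rightarrow> \<lambda>_ _ i j. of_bool (i = x \<and> j = y)) a b i j
        * (case s of (x, y, z) \<Rightarrow> \<lambda>_ _ j k. of_bool (j = y \<and> k = z)) b c j' k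
        * (case s of (x, y, z) \<Rightarrow> \<lambda>_ _ i k. of_bool (i = x \<and> k = z)) a c i' k')
        = (of_bool (i = i' \<and> j = j' \<and> k = k') :: complex)"
      unfolding one by (simp only: sum.insert sum.empty finite.emptyI empty_iff not_False_eq_True
          add_0_right case_prod_unfold)
  qed
  then have "mm_rank_le (card ?N * 1) (card ?N * 1) (card ?N * 1) (\<Sum>s\<in>?T. 1)"
    by (intro mm_rank_le_direct_sum) (use \<open>mm_rank_le 1 1 1 1\<close> in auto)
  then show ?thesis by (simp add: card_cartesian_product power3_eq_cube mult_ac)
qed

section \<open>From tensor rank to programs\<close>

text \<open>
  The recursive step of block matrix multiplication: \<open>r\<close> products of \<open>n \<times> n\<close> blocks, together with
  the linear operations before and after them.
\<close>

lemma mm_computable_blocks: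
  assumes "mm_rank_le M M M r" and q: "mm_computable n q"
  shows "mm_computable (M * n) (r * q + 6 * r * M\<^sup>2 * n\<^sup>2)"
proof -
  obtain u v w where uvw: "mm_decomposition M M M r u v w"
    using assms(1) unfolding mm_rank_le_def by blast
  define N where "N = M * n"
  let ?D = "mm_domain N" and ?I = "mm_inputs N" and ?sq = "\<lambda>n::nat. {..<n} \<times> {..<n}"
  \<comment> \<open>\<open>P t x\<close> and \<open>Q t x\<close> are the factors of the \<open>t\<close>-th recursive product for the input \<open>x\<close>.\<close>
  define P where "P t x = mat n n (\<lambda>(i, j).
    \<Sum>a<M. \<Sum>b<M. u t a b * fst x $$ (a * n + i, b * n + j))" for t and x :: "complex mat \<times> complex mat"
  define Q where "Q t x = mat n n (\<lambda>(i, j).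
    \<Sum>a<M. \<Sum>b<M. v t a b * snd x $$ (a * n + i, b * n + j))" for t and x :: "complex mat \<times> complex mat"
  have fst_in: "(\<lambda>x. fst x $$ (i, j)) \<in> ?I" and snd_in: "(\<lambda>x. snd x $$ (i, j)) \<in> ?I"
    if "i < N" "j < N" for i j
    using that unfolding mm_inputs_eq by auto
  have index: "a * n + i < N" if "a < M" "i < n" for a i
    using block_index_less that unfolding N_def by blast
  have P_entry: "slp_extends ?D ?I ?I {\<lambda>x. P t x $$ (i, j)} (2 * card (?sq M))"
    if "i < n" "j < n" for t i j
  proof -
    have "(\<lambda>x. P t x $$ (i, j)) = (\<lambda>x. \<Sum>y\<in>?sq M. (case y of (a, b) \<Rightarrow> u t a b)
        * (case y of (a, b) \<Rightarrow> \<lambda>x. fst x $$ (a * n + i, b * n + j)) x)"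
      using that by (simp add: P_def sum.cartesian_product case_prod_unfold)
    then show ?thesis
      by (simp only:) (rule slp_extends_lincomb, use that in \<open>auto intro!: fst_in index\<close>)
  qed
  have Q_entry: "slp_extends ?D ?I ?I {\<lambda>x. Q t x $$ (i, j)} (2 * card (?sq M))"
    if "i < n" "j < n" for t i j
  proof -
    have "(\<lambda>x. Q t x $$ (i, j)) = (\<lambda>x. \<Sum>y\<in>?sq M. (case y of (a, b) \<Rightarrow> v t a b)
        * (case y of (a, b) \<Rightarrow> \<lambda>x. snd x $$ (a * n + i, b * n + j)) x)"
      using that by (simp add: Q_def sum.cartesian_product case_prod_unfold)
    then show ?thesis
      by (simp only:) (rule slp_extends_lincomb, use that in \<open>auto intro!: snd_in index\<close>)
  qed
  let ?c = "card (?sq n) * (2 * card (?sq M))"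
  have products: "\<exists>H. slp_extends ?D ?I ?I {H i j | i j. i < n \<and> j < n} (?c + ?c + q) \<and>
      (\<forall>i<n. \<forall>j<n. \<forall>x\<in>?D. H i j x = (P t x * Q t x) $$ (i, j))" for t
  proof -
    let ?FP = "\<Union>(i, j)\<in>?sq n. {\<lambda>x. P t x $$ (i, j)}"
    let ?FQ = "\<Union>(i, j)\<in>?sq n. {\<lambda>x. Q t x $$ (i, j)}"
    have "slp_extends ?D ?I ?I ?FP ?c"
      by (rule slp_extends_UN) (use P_entry in auto)
    moreover have "slp_extends ?D ?I ?I ?FQ ?c"
      by (rule slp_extends_UN) (use Q_entry in auto)
    then have "slp_extends ?D ?I (?I \<union> ?FP) ?FQ ?c"
      by (rule slp_extends_mono) auto
    ultimately have PQ: "slp_extends ?D ?I ?I (?FP \<union> ?FQ) (?c + ?c)"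
      by (rule slp_extends_trans)
    have "\<exists>F. slp_extends ?D ?I (?I \<union> (?FP \<union> ?FQ)) F q \<and>
        (\<forall>i<n. \<forall>j<n. \<exists>h\<in>F. \<forall>x\<in>?D. h x = (P t x * Q t x) $$ (i, j))"
    proof (rule slp_extends_mm[OF q])
      fix i j assume "i < n" "j < n"
      then show "(\<lambda>x. P t x $$ (i, j)) \<in> ?I \<union> (?FP \<union> ?FQ) \<and> (\<lambda>x. Q t x $$ (i, j)) \<in> ?I \<union> (?FP \<union> ?FQ)"
        by blast
    qed (auto simp: P_def Q_def)
    then obtain F where F: "slp_extends ?D ?I (?I \<union> (?FP \<union> ?FQ)) F q"
      "\<forall>i<n. \<forall>j<n. \<exists>h\<in>F. \<forall>x\<in>?D. h x = (P t x * Q t x) $$ (i, j)"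
      by blast
    define H where "H i j = (SOME h. h \<in> F \<and> (\<forall>x\<in>?D. h x = (P t x * Q t x) $$ (i, j)))" for i j
    have H: "H i j \<in> F \<and> (\<forall>x\<in>?D. H i j x = (P t x * Q t x) $$ (i, j))" if "i < n" "j < n" for i j
    proof -
      have "\<exists>h. h \<in> F \<and> (\<forall>x\<in>?D. h x = (P t x * Q t x) $$ (i, j))"
        using F(2)[rule_format, OF that] by (simp only: Bex_def)
      then show ?thesis unfolding H_def by (rule someI_ex)
    qed
    have "{H i j | i j. i < n \<and> j < n} \<subseteq> F" using H by auto
    then have "slp_extends ?D ?I ?I {H i j | i j. i < n \<and> j < n} (?c + ?c + q)"
      by (intro slp_extends_mono[OF slp_extends_trans[OF PQ F(1)]] order_refl) (rule le_supI2)
    moreover have "\<forall>i<n. \<forall>j<n. \<forall>x\<in>?D. H i j x = (P t x * Q t x) $$ (i, j)"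
      using H by auto
    ultimately show ?thesis by (intro exI[of _ H] conjI)
  qed
  \<comment> \<open>\<open>H t i j\<close> is the computed function for the entry \<open>(i, j)\<close> of \<open>P t * Q t\<close>.\<close>
  define H where "H t = (SOME H. slp_extends ?D ?I ?I {H i j | i j. i < n \<and> j < n} (?c + ?c + q) \<and>
      (\<forall>i<n. \<forall>j<n. \<forall>x\<in>?D. H i j x = (P t x * Q t x) $$ (i, j)))" for t
  have H: "slp_extends ?D ?I ?I {H t i j | i j. i < n \<and> j < n} (?c + ?c + q) \<and>
      (\<forall>i<n. \<forall>j<n. \<forall>x\<in>?D. H t i j x = (P t x * Q t x) $$ (i, j))" for t
    using products unfolding H_def by (rule someI_ex)
  let ?FH = "\<Union>t\<in>{..<r}. {H t i j | i j. i < n \<and> j < n}"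
  have FH: "slp_extends ?D ?I ?I ?FH (card {..<r} * (?c + ?c + q))"
    by (rule slp_extends_UN) (use H in auto)
  define out where "out l l' = (\<lambda>x. \<Sum>t<r. w t (l div n) (l' div n) * H t (l mod n) (l' mod n) x)" for l l'
  let ?FO = "\<Union>(l, l')\<in>?sq N. {out l l'}"
  have "slp_extends ?D ?I (?I \<union> ?FH) {out l l'} (2 * card {..<r})" if "l < N" "l' < N" for l l'
  proof -
    have "n > 0" using that unfolding N_def by (auto intro: Nat.gr0I)
    then have "H t (l mod n) (l' mod n) \<in> {H t i j | i j. i < n \<and> j < n}" for t
      unfolding mem_Collect_eq by (intro exI[of _ "l mod n"] exI[of _ "l' mod n"]) simp
    then have "H t (l mod n) (l' mod n) \<in> ?I \<union> ?FH" if "t \<in> {..<r}" for t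
      using that by (intro UnI2 UN_I)
    then show ?thesis
      unfolding out_def by (rule slp_extends_lincomb[OF finite_lessThan])
  qed
  then have "slp_extends ?D ?I (?I \<union> ?FH) ?FO (card (?sq N) * (2 * card {..<r}))"
    by (intro slp_extends_UN) auto
  from slp_extends_trans[OF FH this]
  have ext: "slp_extends ?D ?I ?I (?FH \<union> ?FO)
      (card {..<r} * (?c + ?c + q) + card (?sq N) * (2 * card {..<r}))" .
  have cost: "card {..<r} * (?c + ?c + q) + card (?sq N) * (2 * card {..<r})
      = r * q + 6 * r * M\<^sup>2 * n\<^sup>2"
    by (simp add: N_def power2_eq_square algebra_simps)
  have correct: "out l l' (A, B) = (A * B) $$ (l, l')"
    if ll: "l < N" "l' < N" and AB: "A \<in> carrier_mat N N" "B \<in> carrier_mat N N" for l l' A B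
  proof -
    have n: "n > 0" using ll unfolding N_def by (auto intro: Nat.gr0I)
    let ?a = "l div n" and ?i = "l mod n" and ?c = "l' div n" and ?k = "l' mod n"
    have lt: "?a < M" "?c < M" "?i < n" "?k < n"
      using ll n by (simp_all add: N_def less_mult_imp_div_less)
    have "out l l' (A, B) = (\<Sum>t<r. w t ?a ?c * (P t (A, B) * Q t (A, B)) $$ (?i, ?k))"
      using H lt AB unfolding out_def mm_domain_def by simp
    also have "\<dots> = (\<Sum>t<r. \<Sum>j<n. w t ?a ?c
        * ((\<Sum>a<M. \<Sum>b<M. u t a b * A $$ (a * n + ?i, b * n + j))
         * (\<Sum>b<M. \<Sum>c<M. v t b c * B $$ (b * n + j, c * n + ?k))))"
      using lt by (simp add: P_def Q_def scalar_prod_def atLeast0LessThan sum_distrib_left)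
    also have "\<dots> = (\<Sum>j<n. \<Sum>b<M. A $$ (?a * n + ?i, b * n + j) * B $$ (b * n + j, ?c * n + ?k))"
      unfolding sum.swap[where A = "{..<r}"]
      by (intro sum.cong refl bilinear_identity[OF uvw lt(1,2)])
    also have "\<dots> = (\<Sum>j<n. \<Sum>b<M. A $$ (l, b * n + j) * B $$ (b * n + j, l'))"
      by simp
    also have "\<dots> = (\<Sum>x<N. A $$ (l, x) * B $$ (x, l'))"
      unfolding N_def sum_blocks by (rule sum.swap)
    also have "\<dots> = (A * B) $$ (l, l')"
      using ll AB by (auto simp: scalar_prod_def atLeast0LessThan intro!: sum.cong)
    finally show ?thesis .
  qed
  have "mm_computable N (r * q + 6 * r * M\<^sup>2 * n\<^sup>2)"
  proof (rule mm_computableI[OF ext[unfolded cost]])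
    fix l l' assume ll: "l < N" "l' < N"
    have "out l l' \<in> ?FH \<union> ?FO"
      using ll by blast
    moreover have "\<forall>(A, B)\<in>?D. out l l' (A, B) = (A * B) $$ (l, l')"
      using correct ll unfolding mm_domain_def by blast
    ultimately show "\<exists>h\<in>?FH \<union> ?FO. \<forall>(A, B)\<in>?D. h (A, B) = (A * B) $$ (l, l')"
      by (intro bexI[of _ "out l l'"])
  qed
  then show ?thesis unfolding N_def .
qed

lemma mm_computable_1: "mm_computable 1 1"
proof -
  let ?h = "\<lambda>x :: complex mat \<times> complex mat. fst x $$ (0, 0) * snd x $$ (0, 0)"
  have "slp_extends (mm_domain 1) (mm_inputs 1) (mm_inputs 1) {?h} 1"
  proof (rule slp_extendsI)
    fix S k assume S: "straight_line (mm_domain 1) (mm_inputs 1) S k" "mm_inputs 1 \<subseteq> S"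
    have "(\<lambda>x. fst x $$ (0, 0)) \<in> S" "(\<lambda>x. snd x $$ (0, 0)) \<in> S"
      using S(2) unfolding mm_inputs_eq by auto
    then have "straight_line (mm_domain 1) (mm_inputs 1) (insert ?h S) (Suc k)"
      by (rule straight_line.mult[OF S(1)])
    then show "\<exists>S'. S \<subseteq> S' \<and> {?h} \<subseteq> S' \<and> straight_line (mm_domain 1) (mm_inputs 1) S' (k + 1)"
      by (intro exI[of _ "insert ?h S"]) auto
  qed
  then show ?thesis
    by (rule mm_computableI) (auto simp: mm_domain_def scalar_prod_def)
qed

text \<open>
  Running the recursion.  Since \<open>M\<^sup>2 \<le> r\<close>, counting \<open>r + 1\<close> instead of \<open>r\<close> recursive calls pays for
  the linear operations.
\<close>

lemma mm_computable_powers: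
  assumes "mm_rank_le M M M r"
  shows "\<exists>q. mm_computable (M ^ k) q \<and> q \<le> (6 * r * M\<^sup>2 + 1) * (r + 1) ^ k"
proof (induction k)
  case 0
  show ?case using mm_computable_1 by (intro exI[of _ 1]) simp
next
  case (Suc k)
  let ?C = "6 * r * M\<^sup>2 + 1"
  obtain q where q: "mm_computable (M ^ k) q" "q \<le> ?C * (r + 1) ^ k"
    using Suc by blast
  have "(M\<^sup>2) ^ k \<le> (r + 1) ^ k"
    using mm_rank_lower_bound[OF assms] by (intro power_mono) auto
  then have "6 * r * M\<^sup>2 * (M ^ k)\<^sup>2 \<le> ?C * (r + 1) ^ k"
    by (intro mult_mono) (auto simp flip: power_mult simp: mult.commute)
  moreover have "r * q \<le> r * (?C * (r + 1) ^ k)"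
    using q(2) by simp
  ultimately have "r * q + 6 * r * M\<^sup>2 * (M ^ k)\<^sup>2 \<le> ?C * (r + 1) ^ Suc k"
    by (simp add: algebra_simps)
  then show ?case
    using mm_computable_blocks[OF assms q(1)] by auto
qed

section \<open>The exponent of matrix multiplication\<close>

lemma mm_ops_le: "mm_computable n q \<Longrightarrow> mm_ops n \<le> q"
  unfolding mm_ops_def by (rule Least_le)

lemma mm_computable_mm_ops: "mm_computable n (mm_ops n)"
proof -
  obtain q where "mm_computable (2 ^ n) q"
    using mm_computable_powers[OF mm_rank_le_trivial] by blast
  then have "mm_computable n q"
    by (rule mm_computable_mono) (simp add: less_imp_le)
  then show ?thesis unfolding mm_ops_def by (rule LeastI)
qed

text \<open>
  The set of which \<open>mm_exponent\<close> is the infimum.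
\<close>

definition mm_exponents :: "real set" where
  "mm_exponents = {w. \<exists>e :: nat \<Rightarrow> real. e \<longlonglongrightarrow> 0 \<and>
     (\<forall>\<^sub>F n in sequentially. real (mm_ops n) \<le> real n powr (w + e n))}"

lemma mm_exponent_eq: "mm_exponent = Inf mm_exponents"
  unfolding mm_exponent_def mm_exponents_def ..

text \<open>
  A constant factor is absorbed by the \<open>o(1)\<close> in the exponent.
\<close>

lemma mm_exponentsI:
  assumes "\<And>n. n \<ge> 1 \<Longrightarrow> real (mm_ops n) \<le> C * real n powr w" "C > 0"
  shows "w \<in> mm_exponents"
proof -
  have "(\<lambda>n. ln C / ln (real n)) \<longlonglongrightarrow> 0"
    by real_asymp
  moreover have "real (mm_ops n) \<le> real n powr (w + ln C / ln (real n))" if "n \<ge> 2" for n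
  proof -
    have "ln (real n) > 0" using that by simp
    then have "real n powr (ln C / ln (real n)) = C"
      using that assms(2) by (simp add: powr_def)
    then show ?thesis using assms(1)[of n] that by (simp add: powr_add mult.commute)
  qed
  then have "\<forall>\<^sub>F n in sequentially. real (mm_ops n) \<le> real n powr (w + ln C / ln (real n))"
    using eventually_ge_at_top[of 2] by (rule eventually_mono[rotated])
  ultimately show ?thesis unfolding mm_exponents_def by blast
qed

lemma mm_exponents_ge_2:
  assumes "w \<in> mm_exponents"
  shows "2 \<le> w"
proof (rule ccontr)
  assume "\<not> 2 \<le> w"
  obtain e :: "nat \<Rightarrow> real" where e: "e \<longlonglongrightarrow> 0"
    "\<forall>\<^sub>F n in sequentially. real (mm_ops n) \<le> real n powr (w + e n)"
    using assms unfolding mm_exponents_def by blast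
  define \<delta> where "\<delta> = (2 - w) / 2"
  have "\<delta> > 0" using \<open>\<not> 2 \<le> w\<close> by (simp add: \<delta>_def)
  have "\<forall>\<^sub>F n in sequentially. e n < \<delta>"
    using e(1) \<open>\<delta> > 0\<close> by (rule order_tendstoD)
  moreover have "\<forall>\<^sub>F n in sequentially. real n powr \<delta> > 2"
    using \<open>\<delta> > 0\<close> by real_asymp
  ultimately have "\<forall>\<^sub>F n :: nat in sequentially. False"
    using e(2) eventually_ge_at_top[of 1]
  proof eventually_elim
    case (elim n)
    have "n\<^sup>2 \<le> 2 * mm_ops n"
      by (rule mm_rank_lower_bound) (rule mm_rank_le_of_computable[OF mm_computable_mm_ops])
    then have "(real n)\<^sup>2 \<le> 2 * real (mm_ops n)"
      by (metis of_nat_le_iff of_nat_mult of_nat_numeral of_nat_power)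
    also have "\<dots> \<le> 2 * real n powr (w + e n)" using elim by simp
    also have "\<dots> \<le> 2 * real n powr (2 - \<delta>)"
      using elim by (intro mult_left_mono powr_mono) (auto simp: \<delta>_def field_simps)
    also have "\<dots> < real n powr \<delta> * real n powr (2 - \<delta>)"
      using elim by (intro mult_strict_right_mono) auto
    also have "\<dots> = (real n)\<^sup>2"
      using elim by (simp flip: powr_add)
    finally show False by simp
  qed
  then show False by simp
qed

lemma log_rank_mem_mm_exponents:
  assumes "mm_rank_le M M M r" "M \<ge> 2"
  shows "log (real M) (real r + 1) \<in> mm_exponents" (is "?\<beta> \<in> _")
proof -
  have \<beta>: "real M powr ?\<beta> = real r + 1" "?\<beta> \<ge> 0"
    using assms(2) by auto
  have powr_pow: "(real M powr b) ^ k = real (M ^ k) powr b" for b k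
    using assms(2) by (simp add: powr_powr mult.commute flip: powr_realpow)
  let ?C = "(real (6 * r * M\<^sup>2 + 1)) * (real r + 1)"
  show ?thesis
  proof (rule mm_exponentsI)
    fix n :: nat assume "n \<ge> 1"
    then obtain k where k: "M ^ k \<le> n" "n < M ^ (k + 1)"
      using ex_power_ivl1[OF assms(2)] by blast
    obtain q where q: "mm_computable (M ^ (k + 1)) q" "q \<le> (6 * r * M\<^sup>2 + 1) * (r + 1) ^ (k + 1)"
      using mm_computable_powers[OF assms(1)] by blast
    have "mm_ops n \<le> q"
      using mm_computable_mono[OF q(1)] k(2) by (intro mm_ops_le) auto
    then have "mm_ops n \<le> (6 * r * M\<^sup>2 + 1) * (r + 1) ^ (k + 1)"
      using q(2) by linarith
    then have "real (mm_ops n) \<le> real ((6 * r * M\<^sup>2 + 1) * (r + 1) ^ (k + 1))"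
      by (simp only: of_nat_le_iff)
    also have "\<dots> = ?C * (real r + 1) ^ k"
      by (simp add: algebra_simps)
    also have "(real r + 1) ^ k = (real M powr ?\<beta>) ^ k"
      by (simp only: \<beta>(1))
    also have "\<dots> = real (M ^ k) powr ?\<beta>"
      by (rule powr_pow)
    also have "\<dots> \<le> real n powr ?\<beta>"
      using k(1) \<beta>(2) by (intro powr_mono2) (auto simp flip: of_nat_power)
    finally show "real (mm_ops n) \<le> ?C * real n powr ?\<beta>"
      by (simp add: mult_left_mono)
  next
    have "real (6 * r * M\<^sup>2 + 1) > 0" unfolding of_nat_0_less_iff by simp
    then show "?C > 0" by (rule mult_pos_pos) (simp add: add_nonneg_pos)
  qed
qed

lemma mm_exponent_bounds_rank:
  assumes "mm_rank_le M M M r" "M \<ge> 1"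
  shows "real M powr mm_exponent \<le> real r + 1"
proof (cases "M = 1")
  case False
  then have M: "M \<ge> 2" using assms(2) by simp
  have "mm_exponent \<le> log (real M) (real r + 1)"
    unfolding mm_exponent_eq using log_rank_mem_mm_exponents[OF assms(1) M] mm_exponents_ge_2
    by (intro cInf_lower bdd_belowI)
  then have "real M powr mm_exponent \<le> real M powr log (real M) (real r + 1)"
    using M by (intro powr_mono) auto
  also have "\<dots> = real r + 1" using M by auto
  finally show ?thesis .
qed simp

lemma mm_exponents_nonempty: "mm_exponents \<noteq> {}"
  using log_rank_mem_mm_exponents[OF mm_rank_le_trivial[of 2]] by auto

lemma mm_exponent_ge_2: "2 \<le> mm_exponent"
  unfolding mm_exponent_eq by (rule cInf_greatest[OF mm_exponents_nonempty mm_exponents_ge_2])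

lemma mm_rank_upper_bound:
  assumes "\<beta> > mm_exponent"
  shows "\<exists>C>0. \<forall>n. \<exists>r. mm_rank_le n n n r \<and> real r \<le> C * real n powr \<beta>"
proof -
  obtain w where w: "w \<in> mm_exponents" "w < \<beta>"
    using cInf_lessD[OF mm_exponents_nonempty] assms unfolding mm_exponent_eq by blast
  obtain e :: "nat \<Rightarrow> real" where e: "e \<longlonglongrightarrow> 0"
    "\<forall>\<^sub>F n in sequentially. real (mm_ops n) \<le> real n powr (w + e n)"
    using w(1) unfolding mm_exponents_def by blast
  have "\<forall>\<^sub>F n in sequentially. e n < \<beta> - w"
    using e(1) w(2) by (intro order_tendstoD(2)) auto
  then have "\<forall>\<^sub>F n in sequentially. real (mm_ops n) \<le> real n powr \<beta>"
    using e(2) eventually_ge_at_top[of 1]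
  proof eventually_elim
    case (elim n)
    then have "real n powr (w + e n) \<le> real n powr \<beta>"
      by (intro powr_mono) auto
    with elim show ?case by linarith
  qed
  then obtain N where N: "\<And>n. n \<ge> N \<Longrightarrow> real (mm_ops n) \<le> real n powr \<beta>"
    unfolding eventually_sequentially by blast
  let ?C = "2 + real N ^ 3"
  have "\<exists>r. mm_rank_le n n n r \<and> real r \<le> ?C * real n powr \<beta>" for n
  proof -
    \<comment> \<open>The finitely many \<open>n < N\<close> are covered by the trivial bound and the constant.\<close>
    consider "n = 0" | "n \<ge> 1" "n < N" | "n \<ge> N" by linarith
    then show ?thesis
    proof cases
      case 1
      then show ?thesis using mm_rank_le_trivial[of 0] by auto
    next
      case 2
      have "real n ^ 3 \<le> real N ^ 3"
        using 2 by (intro power_mono) auto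
      then have "real (n ^ 3) \<le> ?C * 1"
        unfolding of_nat_power mult_1_right by linarith
      also have "\<dots> \<le> ?C * real n powr \<beta>"
        using 2 assms mm_exponent_ge_2 by (intro mult_left_mono ge_one_powr_ge_zero) auto
      finally show ?thesis using mm_rank_le_trivial by blast
    next
      case 3
      have "real (2 * mm_ops n) \<le> 2 * real n powr \<beta>"
        using N[OF 3] by simp
      also have "\<dots> \<le> ?C * real n powr \<beta>"
        by (intro mult_right_mono) auto
      finally show ?thesis
        using mm_rank_le_of_computable[OF mm_computable_mm_ops] by blast
    qed
  qed
  moreover have "?C > 0" by (simp add: add_pos_nonneg)
  ultimately show ?thesis by blast
qed

section \<open>Restrictions bound the exponent\<close>

text \<open>
  The additional factor \<open>\<langle>e, e, e\<rangle>\<close> is what makes the induction work: splitting off one copy of the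
  restriction replaces \<open>e\<close> by \<open>d s * e\<close>, so that no powers of direct sums have to be formed.
\<close>

lemma mm_restriction_power_rank:
  assumes fin: "finite S" "finite I" "finite J" "finite K"
    and restr: "mm_restriction I J K S d"
    and C: "C > 0" "\<And>n. \<exists>r. mm_rank_le n n n r \<and> real r \<le> C * real n powr \<beta>"
  shows "\<exists>r. mm_rank_le (card I ^ N * e) (card J ^ N * e) (card K ^ N * e) r \<and>
    real r \<le> C * real e powr \<beta> * (\<Sum>s\<in>S. real (d s) powr \<beta>) ^ N"
proof (induction N arbitrary: e)
  case 0
  then show ?case using C(2) by simp
next
  case (Suc N)
  let ?\<Sigma> = "\<Sum>s\<in>S. real (d s) powr \<beta>"
  let ?m = "card I ^ N * e" and ?n = "card J ^ N * e" and ?p = "card K ^ N * e"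
  have "\<forall>s. \<exists>r. mm_rank_le (d s * ?m) (d s * ?n) (d s * ?p) r \<and>
      real r \<le> C * real (d s * e) powr \<beta> * ?\<Sigma> ^ N"
    using Suc[of "d _ * e"] by (simp add: mult_ac)
  then obtain \<rho> where \<rho>: "\<And>s. mm_rank_le (d s * ?m) (d s * ?n) (d s * ?p) (\<rho> s)"
      "\<And>s. real (\<rho> s) \<le> C * real (d s * e) powr \<beta> * ?\<Sigma> ^ N"
    by metis
  have "mm_rank_le (card I * ?m) (card J * ?n) (card K * ?p) (\<Sum>s\<in>S. \<rho> s)"
    by (rule mm_rank_le_direct_sum[OF fin restr \<rho>(1)])
  moreover have "real (\<Sum>s\<in>S. \<rho> s) \<le> C * real e powr \<beta> * ?\<Sigma> ^ Suc N"
  proof -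
    have "real (\<Sum>s\<in>S. \<rho> s) \<le> (\<Sum>s\<in>S. C * real (d s * e) powr \<beta> * ?\<Sigma> ^ N)"
      unfolding of_nat_sum by (intro sum_mono \<rho>(2))
    also have "\<dots> = (\<Sum>s\<in>S. (C * real e powr \<beta> * ?\<Sigma> ^ N) * real (d s) powr \<beta>)"
      by (simp add: powr_mult mult_ac)
    also have "\<dots> = C * real e powr \<beta> * ?\<Sigma> ^ Suc N"
      by (simp flip: sum_distrib_left)
    finally show ?thesis .
  qed
  ultimately show ?case by (auto simp: mult_ac)
qed

lemma le_of_power_le_const_mult_power:
  fixes a b K :: real
  assumes "b \<ge> 0" "K > 0" "\<And>N. a ^ N \<le> K * b ^ N"
  shows "a \<le> b"
proof (rule ccontr)
  assume "\<not> a \<le> b"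
  then have "b < a" by simp
  show False
  proof (cases "b = 0")
    case True
    then show False using assms(3)[of 1] \<open>b < a\<close> by simp
  next
    case False
    then have "b > 0" using assms(1) by simp
    then have "1 < a / b" using \<open>b < a\<close> by simp
    then obtain N where "K < (a / b) ^ N"
      using real_arch_pow by blast
    then have "K * b ^ N < a ^ N"
      using \<open>b > 0\<close> by (simp add: power_divide field_simps)
    then show False using assms(3)[of N] by simp
  qed
qed

lemma mm_restriction_bound:
  assumes fin: "finite S" "finite I" "finite J" "finite K"
    and restr: "mm_restriction I J K S d"
  shows "real (card I * card J * card K) powr (mm_exponent / 3) \<le> (\<Sum>s\<in>S. real (d s) powr mm_exponent)"
proof (cases "card I * card J * card K = 0")
  case True
  show ?thesis unfolding True by (simp add: sum_nonneg)
next
  case False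
  let ?M = "card I * card J * card K"
  have M: "?M \<ge> 1" using False by simp
  have bound: "real ?M powr (mm_exponent / 3) \<le> (\<Sum>s\<in>S. real (d s) powr \<beta>)"
    if \<beta>: "\<beta> > mm_exponent" for \<beta>
  proof -
    let ?\<Sigma> = "\<Sum>s\<in>S. real (d s) powr \<beta>"
    obtain C where C: "C > 0" "\<And>n. \<exists>r. mm_rank_le n n n r \<and> real r \<le> C * real n powr \<beta>"
      using mm_rank_upper_bound[OF \<beta>] by blast
    have powers: "(real ?M powr mm_exponent) ^ N \<le> 2 * C ^ 3 * (?\<Sigma> ^ 3) ^ N" for N
    proof -
      obtain r where r: "mm_rank_le (card I ^ N) (card J ^ N) (card K ^ N) r" "real r \<le> C * ?\<Sigma> ^ N"
        using mm_restriction_power_rank[OF fin restr C, of N 1] by auto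
      have rank: "mm_rank_le (?M ^ N) (?M ^ N) (?M ^ N) (r ^ 3)"
        using mm_rank_le_cube[OF r(1)] by (simp add: power_mult_distrib)
      have "1 \<le> ?M ^ N" using M by (rule one_le_power)
      then have "1 \<le> (?M ^ N)\<^sup>2" by (rule one_le_power)
      also have "\<dots> \<le> r ^ 3" by (rule mm_rank_lower_bound[OF rank])
      finally have "1 \<le> real (r ^ 3)" by (simp only: real_of_nat_ge_one_iff)
      have "(real ?M powr mm_exponent) ^ N = real (?M ^ N) powr mm_exponent"
        using M by (simp add: powr_powr mult.commute del: of_nat_mult flip: powr_realpow)
      also have "\<dots> \<le> real (r ^ 3) + 1"
        by (rule mm_exponent_bounds_rank[OF rank \<open>1 \<le> ?M ^ N\<close>])
      also have "\<dots> \<le> 2 * real (r ^ 3)"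
        using \<open>1 \<le> real (r ^ 3)\<close> by simp
      also have "real (r ^ 3) \<le> (C * ?\<Sigma> ^ N) ^ 3"
        unfolding of_nat_power using r(2) by (intro power_mono) auto
      also have "2 * (C * ?\<Sigma> ^ N) ^ 3 = 2 * C ^ 3 * (?\<Sigma> ^ 3) ^ N"
        by (simp add: power_mult_distrib mult.commute flip: power_mult)
      finally show ?thesis by simp
    qed
    have "?\<Sigma> ^ 3 \<ge> 0" "2 * C ^ 3 > 0"
      using C(1) by (simp_all add: sum_nonneg)
    then have "real ?M powr mm_exponent \<le> ?\<Sigma> ^ 3"
      by (rule le_of_power_le_const_mult_power[OF _ _ powers])
    moreover have "(real ?M powr (mm_exponent / 3)) ^ 3 = real ?M powr mm_exponent"
      using M by (simp add: powr_powr del: of_nat_mult flip: powr_realpow)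
    ultimately have "(real ?M powr (mm_exponent / 3)) ^ 3 \<le> ?\<Sigma> ^ 3"
      by (simp only:)
    then show ?thesis
      by (rule iffD1[OF power_mono_iff, rotated 3]) (simp_all add: sum_nonneg)
  qed
  have "((\<lambda>\<beta>. \<Sum>s\<in>S. real (d s) powr \<beta>) \<longlongrightarrow> (\<Sum>s\<in>S. real (d s) powr mm_exponent))
      (at_right mm_exponent)"
  proof (rule tendsto_sum)
    fix s
    show "((\<lambda>\<beta>. real (d s) powr \<beta>) \<longlongrightarrow> real (d s) powr mm_exponent) (at_right mm_exponent)"
      by (cases "d s = 0") (auto intro!: tendsto_intros)
  qed
  moreover have "\<forall>\<^sub>F \<beta> in at_right mm_exponent.
      real ?M powr (mm_exponent / 3) \<le> (\<Sum>s\<in>S. real (d s) powr \<beta>)"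
    using bound by (intro eventually_at_right_less[THEN eventually_mono])
  ultimately show ?thesis
    by (rule tendsto_lowerbound) simp
qed

section \<open>The restriction given by separating functions\<close>

lemma RepFun_coefficients:
  assumes "finite R" "f \<in> RepFun G R"
  shows "\<exists>w. \<forall>g. f g = (\<Sum>\<rho>\<in>R. \<Sum>a<rep_dim G \<rho>. \<Sum>c<rep_dim G \<rho>. w \<rho> a c * \<rho> g $$ (a, c))"
proof -
  interpret vector_space "\<lambda>(c :: complex) (f :: _ \<Rightarrow> complex) g. c * f g"
    by (rule vector_space_fun)
  define comb where "comb w = (\<lambda>g. \<Sum>\<rho>\<in>R. \<Sum>a<rep_dim G \<rho>. \<Sum>c<rep_dim G \<rho>. w \<rho> a c * \<rho> g $$ (a, c))" for w
  have sub: "subspace (range comb)"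
  proof (rule subspaceI)
    have "(0 :: _ \<Rightarrow> complex) = comb (\<lambda>_ _ _. 0)" by (simp add: comb_def fun_eq_iff)
    then show "0 \<in> range comb" by blast
  next
    fix f g assume "f \<in> range comb" "g \<in> range comb"
    then obtain w w' where "f = comb w" "g = comb w'" by blast
    then have "f + g = comb (\<lambda>\<rho> a c. w \<rho> a c + w' \<rho> a c)"
      by (simp add: comb_def fun_eq_iff sum.distrib distrib_right)
    then show "f + g \<in> range comb" by blast
  next
    fix k and f :: "_ \<Rightarrow> complex" assume "f \<in> range comb"
    then obtain w where "f = comb w" by blast
    then have "(\<lambda>g. k * f g) = comb (\<lambda>\<rho> a c. k * w \<rho> a c)"
      by (simp add: comb_def fun_eq_iff sum_distrib_left mult.assoc)
    then show "(\<lambda>g. k * f g) \<in> range comb" by blast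
  qed
  have "rep_functions G \<rho> \<subseteq> range comb" if "\<rho> \<in> R" for \<rho>
    unfolding rep_functions_def fun_span_def
  proof (rule span_minimal[OF _ sub], safe)
    fix i j assume "i < rep_dim G \<rho>" "j < rep_dim G \<rho>"
    have if_mult: "(if P then x else 0) * y = (if P then x * y else 0)" for P and x y :: complex
      by simp
    let ?w = "\<lambda>\<rho>' a c. if \<rho>' = \<rho> then if a = i then if c = j then 1 else 0 else 0 else 0"
    have eq: "comb ?w = (\<lambda>g. \<rho> g $$ (i, j))"
      using \<open>i < _\<close> \<open>j < _\<close> that assms(1) by (simp add: comb_def if_mult sum_if_const)
    have "comb ?w \<in> range comb" by (rule rangeI)
    then show "(\<lambda>g. \<rho> g $$ (i, j)) \<in> range comb" unfolding eq .
  qed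
  then have "RepFun G R \<subseteq> range comb"
    unfolding RepFun_def fun_span_def by (intro span_minimal[OF _ sub]) blast
  then obtain w where "f = comb w" using assms(2) by blast
  then show ?thesis unfolding comb_def by auto
qed

lemma fin_dim_rep_carrier:
  assumes "fin_dim_rep G \<rho>" "g \<in> carrier G"
  shows "\<rho> g \<in> carrier_mat (rep_dim G \<rho>) (rep_dim G \<rho>)"
proof -
  have "\<rho> g \<in> carrier (GL (rep_dim G \<rho>))"
    using assms unfolding fin_dim_rep_def by (simp add: hom_in_carrier)
  then show ?thesis
    by (auto simp: GL_def units_of_carrier Units_def ring_mat_simps)
qed

lemma fin_dim_rep_mult:
  assumes "fin_dim_rep G \<rho>" "g \<in> carrier G" "h \<in> carrier G"
  shows "\<rho> (g \<otimes>\<^bsub>G\<^esub> h) = \<rho> g * \<rho> h"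
  using assms unfolding fin_dim_rep_def by (simp add: hom_mult GL_def units_of_mult ring_mat_simps)

lemma separating_functions_quadruple:
  assumes "group G" "X \<subseteq> carrier G" "Y \<subseteq> carrier G" "Z \<subseteq> carrier G"
    and tpp: "triple_product_property G X Y Z" and sep: "separating_functions G X Y Z f"
    and mem: "x \<in> X" "x' \<in> X" "y \<in> Y" "y' \<in> Y" "z \<in> Z" "z' \<in> Z"
  shows "f x' z' ((x \<otimes>\<^bsub>G\<^esub> inv\<^bsub>G\<^esub> y) \<otimes>\<^bsub>G\<^esub> (y' \<otimes>\<^bsub>G\<^esub> inv\<^bsub>G\<^esub> z))
    = of_bool (x = x' \<and> y = y' \<and> z = z')"
proof -
  interpret group G by fact
  have carr: "x \<in> carrier G" "x' \<in> carrier G" "y \<in> carrier G" "y' \<in> carrier G"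
    "z \<in> carrier G" "z' \<in> carrier G"
    using assms by auto
  let ?g = "(x \<otimes>\<^bsub>G\<^esub> inv\<^bsub>G\<^esub> y) \<otimes>\<^bsub>G\<^esub> (y' \<otimes>\<^bsub>G\<^esub> inv\<^bsub>G\<^esub> z)"
  have cancel: "inv\<^bsub>G\<^esub> a \<otimes>\<^bsub>G\<^esub> (a \<otimes>\<^bsub>G\<^esub> b) = b" if "a \<in> carrier G" "b \<in> carrier G" for a b
    using that by (simp flip: m_assoc)
  have mult_mem: "a \<otimes>\<^bsub>G\<^esub> b \<in> A <#>\<^bsub>G\<^esub> B" if "a \<in> A" "b \<in> B" for a b A B
    using that unfolding set_mult_def by auto
  have g_mem: "?g \<in> X <#>\<^bsub>G\<^esub> (set_inv\<^bsub>G\<^esub> Y) <#>\<^bsub>G\<^esub> Y <#>\<^bsub>G\<^esub> (set_inv\<^bsub>G\<^esub> Z)"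
  proof -
    have "?g = x \<otimes>\<^bsub>G\<^esub> inv\<^bsub>G\<^esub> y \<otimes>\<^bsub>G\<^esub> y' \<otimes>\<^bsub>G\<^esub> inv\<^bsub>G\<^esub> z"
      using carr by (simp add: m_assoc)
    moreover have "inv\<^bsub>G\<^esub> y \<in> set_inv\<^bsub>G\<^esub> Y" "inv\<^bsub>G\<^esub> z \<in> set_inv\<^bsub>G\<^esub> Z"
      using mem unfolding SET_INV_def by auto
    then have "x \<otimes>\<^bsub>G\<^esub> inv\<^bsub>G\<^esub> y \<otimes>\<^bsub>G\<^esub> y' \<otimes>\<^bsub>G\<^esub> inv\<^bsub>G\<^esub> z
        \<in> X <#>\<^bsub>G\<^esub> (set_inv\<^bsub>G\<^esub> Y) <#>\<^bsub>G\<^esub> Y <#>\<^bsub>G\<^esub> (set_inv\<^bsub>G\<^esub> Z)"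
      using mem by (intro mult_mem)
    ultimately show ?thesis by simp
  qed
  have "x = x' \<and> y = y' \<and> z = z'" if "?g = x' \<otimes>\<^bsub>G\<^esub> inv\<^bsub>G\<^esub> z'"
  proof -
    have "inv\<^bsub>G\<^esub> x' \<otimes>\<^bsub>G\<^esub> x \<otimes>\<^bsub>G\<^esub> inv\<^bsub>G\<^esub> y \<otimes>\<^bsub>G\<^esub> y' \<otimes>\<^bsub>G\<^esub> inv\<^bsub>G\<^esub> z \<otimes>\<^bsub>G\<^esub> z'
        = inv\<^bsub>G\<^esub> x' \<otimes>\<^bsub>G\<^esub> ?g \<otimes>\<^bsub>G\<^esub> z'"
      using carr by (simp add: m_assoc)
    also have "\<dots> = \<one>\<^bsub>G\<^esub>"
      unfolding that using carr by (simp add: m_assoc cancel)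
    finally show ?thesis
      using tpp[unfolded triple_product_property_def, rule_format,
          OF mem(2,1,3,4,5,6)] by simp
  qed
  moreover have "?g = x' \<otimes>\<^bsub>G\<^esub> inv\<^bsub>G\<^esub> z'" if "x = x' \<and> y = y' \<and> z = z'"
    using that carr by (simp add: m_assoc cancel)
  ultimately show ?thesis
    using sep g_mem mem unfolding separating_functions_def by (cases "?g = x' \<otimes>\<^bsub>G\<^esub> inv\<^bsub>G\<^esub> z'") auto
qed

lemma separating_functions_restriction:
  assumes G: "group G" "X \<subseteq> carrier G" "Y \<subseteq> carrier G" "Z \<subseteq> carrier G"
    and tpp: "triple_product_property G X Y Z"
    and R: "finite R" "\<forall>\<rho>\<in>R. fin_dim_rep G \<rho>"
    and sep: "separating_functions G X Y Z f" and f: "\<forall>x\<in>X. \<forall>z\<in>Z. f x z \<in> RepFun G R"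
  shows "mm_restriction X Y Z R (rep_dim G)"
proof -
  interpret group G by fact
  let ?d = "rep_dim G"
  have ex: "\<exists>w. \<forall>g. f x z g = (\<Sum>\<rho>\<in>R. \<Sum>a<?d \<rho>. \<Sum>c<?d \<rho>. w \<rho> a c * \<rho> g $$ (a, c))"
    if "x \<in> X" "z \<in> Z" for x z
    using RepFun_coefficients[OF R(1)] f that by blast
  define w where "w x z = (SOME w. \<forall>g. f x z g
      = (\<Sum>\<rho>\<in>R. \<Sum>a<?d \<rho>. \<Sum>c<?d \<rho>. w \<rho> a c * \<rho> g $$ (a, c)))" for x z
  have w: "f x z g = (\<Sum>\<rho>\<in>R. \<Sum>a<?d \<rho>. \<Sum>c<?d \<rho>. w x z \<rho> a c * \<rho> g $$ (a, c))"
    if "x \<in> X" "z \<in> Z" for x z g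
    using someI_ex[OF ex[OF that]] unfolding w_def by blast
  show ?thesis
  proof (rule mm_restrictionI[where U = "\<lambda>\<rho> a b x y. \<rho> (x \<otimes>\<^bsub>G\<^esub> inv\<^bsub>G\<^esub> y) $$ (a, b)"
        and V = "\<lambda>\<rho> b c y z. \<rho> (y \<otimes>\<^bsub>G\<^esub> inv\<^bsub>G\<^esub> z) $$ (b, c)" and W = "\<lambda>\<rho> a c x z. w x z \<rho> a c"])
    fix x y y' z x' z' assume mem: "x \<in> X" "y \<in> Y" "y' \<in> Y" "z \<in> Z" "x' \<in> X" "z' \<in> Z"
    let ?g = "x \<otimes>\<^bsub>G\<^esub> inv\<^bsub>G\<^esub> y" and ?h = "y' \<otimes>\<^bsub>G\<^esub> inv\<^bsub>G\<^esub> z"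
    have "x \<in> carrier G" "y \<in> carrier G" "y' \<in> carrier G" "z \<in> carrier G"
      using mem G by auto
    then have gh: "?g \<in> carrier G" "?h \<in> carrier G" by simp_all
    have "of_bool (x = x' \<and> y = y' \<and> z = z') = f x' z' (?g \<otimes>\<^bsub>G\<^esub> ?h)"
      using separating_functions_quadruple[OF G tpp sep] mem by simp
    also have "\<dots> = (\<Sum>\<rho>\<in>R. \<Sum>a<?d \<rho>. \<Sum>c<?d \<rho>. w x' z' \<rho> a c * \<rho> (?g \<otimes>\<^bsub>G\<^esub> ?h) $$ (a, c))"
      using w mem by simp
    also have "\<dots> = (\<Sum>\<rho>\<in>R. \<Sum>a<?d \<rho>. \<Sum>c<?d \<rho>. \<Sum>b<?d \<rho>.
        \<rho> ?g $$ (a, b) * \<rho> ?h $$ (b, c) * w x' z' \<rho> a c)"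
    proof (rule sum.cong[OF refl])
      fix \<rho> assume "\<rho> \<in> R"
      then have \<rho>: "fin_dim_rep G \<rho>" using R(2) by blast
      show "(\<Sum>a<?d \<rho>. \<Sum>c<?d \<rho>. w x' z' \<rho> a c * \<rho> (?g \<otimes>\<^bsub>G\<^esub> ?h) $$ (a, c))
          = (\<Sum>a<?d \<rho>. \<Sum>c<?d \<rho>. \<Sum>b<?d \<rho>. \<rho> ?g $$ (a, b) * \<rho> ?h $$ (b, c) * w x' z' \<rho> a c)"
        unfolding fin_dim_rep_mult[OF \<rho> gh]
        using fin_dim_rep_carrier[OF \<rho> gh(1)] fin_dim_rep_carrier[OF \<rho> gh(2)]
        by (intro sum.cong refl)
          (auto simp: scalar_prod_def atLeast0LessThan sum_distrib_left mult_ac)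
    qed
    also have "\<dots> = (\<Sum>\<rho>\<in>R. \<Sum>a<?d \<rho>. \<Sum>b<?d \<rho>. \<Sum>c<?d \<rho>.
        \<rho> ?g $$ (a, b) * \<rho> ?h $$ (b, c) * w x' z' \<rho> a c)"
      by (intro sum.cong refl sum.swap)
    finally show "(\<Sum>\<rho>\<in>R. \<Sum>a<?d \<rho>. \<Sum>b<?d \<rho>. \<Sum>c<?d \<rho>.
        \<rho> ?g $$ (a, b) * \<rho> ?h $$ (b, c) * w x' z' \<rho> a c) = of_bool (x = x' \<and> y = y' \<and> z = z')"
      by simp
  qed
qed

theorem theorem1:
  fixes G :: "('g, 'm) monoid_scheme"
    and X Y Z :: "'g set"
    and R\<^sub>s\<^sub>e\<^sub>p :: "('g \<Rightarrow> complex mat) set"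
  assumes "group G"
    and "finite X" "X \<subseteq> carrier G"
    and "finite Y" "Y \<subseteq> carrier G"
    and "finite Z" "Z \<subseteq> carrier G"
    and "triple_product_property G X Y Z"
    and "finite R\<^sub>s\<^sub>e\<^sub>p" "\<forall>\<rho>\<in>R\<^sub>s\<^sub>e\<^sub>p. fin_dim_rep G \<rho>"
    and "\<exists>f. separating_functions G X Y Z f \<and> (\<forall>x\<in>X. \<forall>z\<in>Z. f x z \<in> RepFun G R\<^sub>s\<^sub>e\<^sub>p)"
  shows "real (card X * card Y * card Z) powr (mm_exponent / 3)
           \<le> (\<Sum>\<rho>\<in>R\<^sub>s\<^sub>e\<^sub>p. real (rep_dim G \<rho>) powr mm_exponent) \<and>
         (let D = (\<Sum>\<rho>\<in>R\<^sub>s\<^sub>e\<^sub>p. (rep_dim G \<rho>)\<^sup>2); d\<^sub>m\<^sub>a\<^sub>x = Max (rep_dim G ` R\<^sub>s\<^sub>e\<^sub>p)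
          in real (card X * card Y * card Z) powr (mm_exponent / 3)
               \<le> real D * real d\<^sub>m\<^sub>a\<^sub>x powr (mm_exponent - 2))"
proof -
  let ?R = "R\<^sub>s\<^sub>e\<^sub>p" and ?d = "rep_dim G" and ?dmax = "Max (rep_dim G ` R\<^sub>s\<^sub>e\<^sub>p)"
  obtain f where f: "separating_functions G X Y Z f" "\<forall>x\<in>X. \<forall>z\<in>Z. f x z \<in> RepFun G ?R"
    using assms(11) by blast
  have "mm_restriction X Y Z ?R ?d"
    by (rule separating_functions_restriction[OF assms(1,3,5,7,8,9,10) f])
  then have main: "real (card X * card Y * card Z) powr (mm_exponent / 3)
      \<le> (\<Sum>\<rho>\<in>?R. real (?d \<rho>) powr mm_exponent)"
    by (rule mm_restriction_bound[OF assms(9,2,4,6)])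
  have "real (?d \<rho>) powr mm_exponent \<le> real ((?d \<rho>)\<^sup>2) * real ?dmax powr (mm_exponent - 2)"
    if "\<rho> \<in> ?R" for \<rho>
  proof (cases "?d \<rho> = 0")
    case False
    have "real (?d \<rho>) powr mm_exponent = real (?d \<rho>) powr 2 * real (?d \<rho>) powr (mm_exponent - 2)"
      by (subst powr_add[symmetric]) simp
    also have "\<dots> = real ((?d \<rho>)\<^sup>2) * real (?d \<rho>) powr (mm_exponent - 2)"
      using False by simp
    also have "\<dots> \<le> real ((?d \<rho>)\<^sup>2) * real ?dmax powr (mm_exponent - 2)"
      using that assms(9) mm_exponent_ge_2 by (intro mult_left_mono powr_mono2) auto
    finally show ?thesis .
  qed simp
  then have "(\<Sum>\<rho>\<in>?R. real (?d \<rho>) powr mm_exponent)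
      \<le> (\<Sum>\<rho>\<in>?R. real ((?d \<rho>)\<^sup>2) * real ?dmax powr (mm_exponent - 2))"
    by (rule sum_mono)
  also have "\<dots> = real (\<Sum>\<rho>\<in>?R. (?d \<rho>)\<^sup>2) * real ?dmax powr (mm_exponent - 2)"
    by (simp add: sum_distrib_right)
  finally show ?thesis
    using main unfolding Let_def by simp
qed

end
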